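(* When $\mathcal S$ is a class of monomorphisms in $\mathcal C$, then the category $\mathsf{Retr}(\mathcal C,\mathcal S)$ is (isomorphic to) the category of fractions $\mathcal C[\mathcal S^{-1}]$.
   Context: Standing assumptions: $\mathcal C$ is a category and $\mathcal S$ is a class of morphisms of $\mathcal C$ that contains all isomorphisms, is closed under composition, and is such that pullbacks of $\mathcal S$-morphisms along arbitrary morphisms exist in $\mathcal C$ and belong to $\mathcal S$. The category of fractions $\mathcal C[\mathcal S^{-1}]$ is characterized by its localizing functor $\mathcal C\to\mathcal C[\mathcal S^{-1}]$: it maps morphisms in $\mathcal S$ to isomorphisms, and every functor on $\mathcal C$ mapping morphisms in $\mathcal S$ to isomorphisms factors uniquely through it. An $\mathcal S$-span $(s,f):A\to B$ is a pair $s:D\to A$ in $\mathcal S$, $f:D\to B$ in $\mathcal C$. A morphism $x:(s,f)\to(\tilde s,\tilde f)$ of $\mathcal S$-spans from $A$ to $B$ is a $\mathcal C$-morphism $x$ with $\tilde s\cdot x=s$, $\tilde f\cdot x=f$. Isomorphic $\mathcal S$-spans are identified. $\mathsf{Span}(\mathcal C,\mathcal S)$ is the category with the objects of $\mathcal C$ and (isomorphism classes of) $\mathcal S$-spans as morphisms, with composition $(t,g)\cdot(s,f)=(s\cdot t',g\cdot f')$, where $f\cdot t'=t\cdot f'$ is a pullback square. $\sim_{\mathrm z}$ is the least equivalence relation on $\mathcal S$-spans relating $(s,f)$ and $(\tilde s,\tilde f)$ whenever there is a morphism $x:(s,f)\to(\tilde s,\tilde f)$ with $x\in\mathcal S$;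 it is preserved by composition, and $\mathsf{Retr}(\mathcal C,\mathcal S)$ is the quotient category of $\mathsf{Span}(\mathcal C,\mathcal S)$ by $\sim_{\mathrm z}$. *)

theory Defs
  imports Main
begin

section \<open>Categories and functors\<close>

record ('o, 'a) cat =
  Obj  :: "'o set"
  Arr  :: "'a set"
  Dom  :: "'a \<Rightarrow> 'o"
  Cod  :: "'a \<Rightarrow> 'o"
  Idt  :: "'o \<Rightarrow> 'a"
  Comp :: "'a \<Rightarrow> 'a \<Rightarrow> 'a"  (infixr "\<cdot>\<index>" 70)

text \<open>Composition is written in applicative order: \<open>g \<cdot>\<^bsub>C\<^esub> f\<close> is \<open>f\<close> followed by \<open>g\<close>.
  Outside the carriers, and on pairs that do not compose, the operations are unconstrained.\<close>

locale category =
  fixes C :: "('o, 'a) cat"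
  assumes Dom_closed: "f \<in> Arr C \<Longrightarrow> Dom C f \<in> Obj C"
    and Cod_closed: "f \<in> Arr C \<Longrightarrow> Cod C f \<in> Obj C"
    and Idt_closed: "A \<in> Obj C \<Longrightarrow> Idt C A \<in> Arr C"
    and Dom_Idt: "A \<in> Obj C \<Longrightarrow> Dom C (Idt C A) = A"
    and Cod_Idt: "A \<in> Obj C \<Longrightarrow> Cod C (Idt C A) = A"
    and Comp_closed: "f \<in> Arr C \<Longrightarrow> g \<in> Arr C \<Longrightarrow> Dom C g = Cod C f \<Longrightarrow> g \<cdot>\<^bsub>C\<^esub> f \<in> Arr C"
    and Dom_Comp: "f \<in> Arr C \<Longrightarrow> g \<in> Arr C \<Longrightarrow> Dom C g = Cod C f \<Longrightarrow> Dom C (g \<cdot>\<^bsub>C\<^esub> f) = Dom C f"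
    and Cod_Comp: "f \<in> Arr C \<Longrightarrow> g \<in> Arr C \<Longrightarrow> Dom C g = Cod C f \<Longrightarrow> Cod C (g \<cdot>\<^bsub>C\<^esub> f) = Cod C g"
    and Comp_assoc: "f \<in> Arr C \<Longrightarrow> g \<in> Arr C \<Longrightarrow> h \<in> Arr C \<Longrightarrow>
      Dom C g = Cod C f \<Longrightarrow> Dom C h = Cod C g \<Longrightarrow> (h \<cdot>\<^bsub>C\<^esub> g) \<cdot>\<^bsub>C\<^esub> f = h \<cdot>\<^bsub>C\<^esub> (g \<cdot>\<^bsub>C\<^esub> f)"
    and Comp_Idt: "f \<in> Arr C \<Longrightarrow> f \<cdot>\<^bsub>C\<^esub> Idt C (Dom C f) = f"
    and Idt_Comp: "f \<in> Arr C \<Longrightarrow> Idt C (Cod C f) \<cdot>\<^bsub>C\<^esub> f = f"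

definition isomorphism :: "('o, 'a) cat \<Rightarrow> 'a \<Rightarrow> bool" where
  "isomorphism C f \<longleftrightarrow> f \<in> Arr C \<and>
     (\<exists>g\<in>Arr C. Dom C g = Cod C f \<and> Cod C g = Dom C f \<and>
        g \<cdot>\<^bsub>C\<^esub> f = Idt C (Dom C f) \<and> f \<cdot>\<^bsub>C\<^esub> g = Idt C (Cod C f))"

definition monomorphism :: "('o, 'a) cat \<Rightarrow> 'a \<Rightarrow> bool" where
  "monomorphism C m \<longleftrightarrow> m \<in> Arr C \<and>
     (\<forall>x\<in>Arr C. \<forall>y\<in>Arr C. Cod C x = Dom C m \<longrightarrow> Cod C y = Dom C m \<longrightarrow> Dom C x = Dom C y \<longrightarrow>
        m \<cdot>\<^bsub>C\<^esub> x = m \<cdot>\<^bsub>C\<^esub> y \<longrightarrow> x = y)"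

text \<open>\<open>is_pullback C f t t' f'\<close>: the square \<open>f \<cdot> t' = t \<cdot> f'\<close> is a pullback, so that \<open>t'\<close> is a
  pullback of \<open>t\<close> along \<open>f\<close>.\<close>

definition is_pullback :: "('o, 'a) cat \<Rightarrow> 'a \<Rightarrow> 'a \<Rightarrow> 'a \<Rightarrow> 'a \<Rightarrow> bool" where
  "is_pullback C f t t' f' \<longleftrightarrow>
     {f, t, t', f'} \<subseteq> Arr C \<and> Cod C f = Cod C t \<and> Dom C t' = Dom C f' \<and>
     Cod C t' = Dom C f \<and> Cod C f' = Dom C t \<and> f \<cdot>\<^bsub>C\<^esub> t' = t \<cdot>\<^bsub>C\<^esub> f' \<and>
     (\<forall>u\<in>Arr C. \<forall>v\<in>Arr C. Dom C u = Dom C v \<longrightarrow> Cod C u = Dom C f \<longrightarrow> Cod C v = Dom C t \<longrightarrow>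
        f \<cdot>\<^bsub>C\<^esub> u = t \<cdot>\<^bsub>C\<^esub> v \<longrightarrow>
        (\<exists>!w. w \<in> Arr C \<and> Dom C w = Dom C u \<and> Cod C w = Dom C t' \<and>
              t' \<cdot>\<^bsub>C\<^esub> w = u \<and> f' \<cdot>\<^bsub>C\<^esub> w = v))"

record ('o, 'a, 'p, 'b) func =
  omap :: "'o \<Rightarrow> 'p"
  amap :: "'a \<Rightarrow> 'b"

definition is_functor :: "('o, 'a) cat \<Rightarrow> ('p, 'b) cat \<Rightarrow> ('o, 'a, 'p, 'b) func \<Rightarrow> bool" where
  "is_functor C D F \<longleftrightarrow> category C \<and> category D \<and>
     (\<forall>A\<in>Obj C. omap F A \<in> Obj D \<and> amap F (Idt C A) = Idt D (omap F A)) \<and>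
     (\<forall>f\<in>Arr C. amap F f \<in> Arr D \<and> Dom D (amap F f) = omap F (Dom C f) \<and>
        Cod D (amap F f) = omap F (Cod C f)) \<and>
     (\<forall>f\<in>Arr C. \<forall>g\<in>Arr C. Dom C g = Cod C f \<longrightarrow>
        amap F (g \<cdot>\<^bsub>C\<^esub> f) = amap F g \<cdot>\<^bsub>D\<^esub> amap F f)"

text \<open>Functors are compared only on the carriers of their domain.\<close>

definition functor_eq :: "('o, 'a) cat \<Rightarrow> ('o, 'a, 'p, 'b) func \<Rightarrow> ('o, 'a, 'p, 'b) func \<Rightarrow> bool" where
  "functor_eq C F G \<longleftrightarrow>
     (\<forall>A\<in>Obj C. omap F A = omap G A) \<and> (\<forall>f\<in>Arr C. amap F f = amap G f)"

definition id_functor :: "('o, 'a, 'o, 'a) func" where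
  "id_functor = \<lparr>omap = id, amap = id\<rparr>"

definition comp_functor ::
    "('p, 'b, 'q, 'c) func \<Rightarrow> ('o, 'a, 'p, 'b) func \<Rightarrow> ('o, 'a, 'q, 'c) func" where
  "comp_functor G F = \<lparr>omap = omap G \<circ> omap F, amap = amap G \<circ> amap F\<rparr>"

definition category_iso :: "('o, 'a) cat \<Rightarrow> ('p, 'b) cat \<Rightarrow> ('o, 'a, 'p, 'b) func \<Rightarrow> bool" where
  "category_iso C D I \<longleftrightarrow> is_functor C D I \<and>
     (\<exists>J. is_functor D C J \<and> functor_eq C (comp_functor J I) id_functor \<and>
          functor_eq D (comp_functor I J) id_functor)"


section \<open>Categories of fractions\<close>

definition inverts :: "'a set \<Rightarrow> ('p, 'b) cat \<Rightarrow> ('o, 'a, 'p, 'b) func \<Rightarrow> bool" where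
  "inverts S D F \<longleftrightarrow> (\<forall>s\<in>S. isomorphism D (amap F s))"

text \<open>The functor \<open>L : C \<rightarrow> K\<close> exhibits \<open>K\<close> as the category of fractions of \<open>C\<close> with respect to
  \<open>S\<close>. A definition cannot quantify over types, so the types of objects and arrows of the
  categories \<open>D\<close> that test the universal property are a parameter; the full universal
  property is this predicate for arbitrary \<open>'q\<close> and \<open>'c\<close>.\<close>

definition category_of_fractions ::
    "('o, 'a) cat \<Rightarrow> 'a set \<Rightarrow> ('p, 'b) cat \<Rightarrow> ('o, 'a, 'p, 'b) func \<Rightarrow> ('q \<times> 'c) itself \<Rightarrow> bool" where
  "category_of_fractions C S K L (_ :: ('q \<times> 'c) itself) \<longleftrightarrow>
     is_functor C K L \<and> inverts S K L \<and>
     (\<forall>(D :: ('q, 'c) cat) F. is_functor C D F \<and> inverts S D F \<longrightarrow>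
        (\<exists>G. is_functor K D G \<and> functor_eq C (comp_functor G L) F \<and>
             (\<forall>G'. is_functor K D G' \<and> functor_eq C (comp_functor G' L) F \<longrightarrow>
                functor_eq K G' G)))"


section \<open>Spans\<close>

locale span_base = category C for C :: "('o, 'a) cat" +
  fixes S :: "'a set"
  assumes S_Arr: "S \<subseteq> Arr C"
    and S_iso: "isomorphism C f \<Longrightarrow> f \<in> S"
    and S_Comp: "s \<in> S \<Longrightarrow> t \<in> S \<Longrightarrow> Dom C t = Cod C s \<Longrightarrow> t \<cdot>\<^bsub>C\<^esub> s \<in> S"
    and S_pullback_ex: "t \<in> S \<Longrightarrow> f \<in> Arr C \<Longrightarrow> Cod C f = Cod C t \<Longrightarrow>
      \<exists>t' f'. is_pullback C f t t' f'"
    and S_pullback: "t \<in> S \<Longrightarrow> is_pullback C f t t' f' \<Longrightarrow> t' \<in> S"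

text \<open>The end objects of a span \<open>(s, f)\<close> are \<open>Cod C s\<close> and \<open>Cod C f\<close>; hence \<open>span_mor\<close>
  relates only spans with the same end objects.\<close>

definition spans :: "('o, 'a) cat \<Rightarrow> 'a set \<Rightarrow> ('a \<times> 'a) set" where
  "spans C S = {(s, f). s \<in> S \<and> f \<in> Arr C \<and> Dom C s = Dom C f}"

definition span_mor :: "('o, 'a) cat \<Rightarrow> 'a \<times> 'a \<Rightarrow> 'a \<times> 'a \<Rightarrow> 'a \<Rightarrow> bool" where
  "span_mor C p q x \<longleftrightarrow> x \<in> Arr C \<and> Dom C x = Dom C (fst p) \<and> Cod C x = Dom C (fst q) \<and>
     fst q \<cdot>\<^bsub>C\<^esub> x = fst p \<and> snd q \<cdot>\<^bsub>C\<^esub> x = snd p"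

definition span_iso :: "('o, 'a) cat \<Rightarrow> 'a set \<Rightarrow> (('a \<times> 'a) \<times> ('a \<times> 'a)) set" where
  "span_iso C S = {(p, q). p \<in> spans C S \<and> q \<in> spans C S \<and>
     (\<exists>x y. span_mor C p q x \<and> span_mor C q p y \<and>
        y \<cdot>\<^bsub>C\<^esub> x = Idt C (Dom C (fst p)) \<and> x \<cdot>\<^bsub>C\<^esub> y = Idt C (Dom C (fst q)))}"

abbreviation span_class :: "('o, 'a) cat \<Rightarrow> 'a set \<Rightarrow> 'a \<times> 'a \<Rightarrow> ('a \<times> 'a) set" where
  "span_class C S p \<equiv> span_iso C S `` {p}"

text \<open>Composition collects the classes of the composites over all representatives and all
  pullback squares. As these composites are isomorphic to each other, the result is a single
  isomorphism class.\<close>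

definition Span :: "('o, 'a) cat \<Rightarrow> 'a set \<Rightarrow> ('o, ('a \<times> 'a) set) cat" where
  "Span C S = \<lparr>
     Obj = Obj C,
     Arr = spans C S // span_iso C S,
     Dom = (\<lambda>X. Cod C (fst (SOME p. p \<in> X))),
     Cod = (\<lambda>X. Cod C (snd (SOME p. p \<in> X))),
     Idt = (\<lambda>A. span_class C S (Idt C A, Idt C A)),
     Comp = (\<lambda>Y X. \<Union> {span_class C S (s \<cdot>\<^bsub>C\<^esub> t', g \<cdot>\<^bsub>C\<^esub> f') | s f t g t' f'.
               (s, f) \<in> X \<and> (t, g) \<in> Y \<and> is_pullback C f t t' f'})\<rparr>"

text \<open>The relation generating \<open>\<sim>\<^sub>z\<close>, and \<open>\<sim>\<^sub>z\<close> itself, live on isomorphism classes of spans.\<close>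

definition z_step :: "('o, 'a) cat \<Rightarrow> 'a set \<Rightarrow> (('a \<times> 'a) set \<times> ('a \<times> 'a) set) set" where
  "z_step C S = {(span_class C S p, span_class C S q) | p q.
     p \<in> spans C S \<and> q \<in> spans C S \<and> (\<exists>x\<in>S. span_mor C p q x)}"

definition z_rel :: "('o, 'a) cat \<Rightarrow> 'a set \<Rightarrow> (('a \<times> 'a) set \<times> ('a \<times> 'a) set) set" where
  "z_rel C S = \<Inter> {R. equiv (Arr (Span C S)) R \<and> z_step C S \<subseteq> R}"

text \<open>The quotient of a category by an equivalence relation on its arrows. It is meaningful when
  \<open>R\<close> relates only arrows with the same domain and codomain and is preserved by composition.\<close>

definition quotient_cat :: "('o, 'a) cat \<Rightarrow> ('a \<times> 'a) set \<Rightarrow> ('o, 'a set) cat" where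
  "quotient_cat C R = \<lparr>
     Obj = Obj C,
     Arr = Arr C // R,
     Dom = (\<lambda>X. Dom C (SOME x. x \<in> X)),
     Cod = (\<lambda>X. Cod C (SOME x. x \<in> X)),
     Idt = (\<lambda>A. R `` {Idt C A}),
     Comp = (\<lambda>Y X. \<Union> {R `` {y \<cdot>\<^bsub>C\<^esub> x} | x y. x \<in> X \<and> y \<in> Y})\<rparr>"

definition Retr :: "('o, 'a) cat \<Rightarrow> 'a set \<Rightarrow> ('o, ('a \<times> 'a) set set) cat" where
  "Retr C S = quotient_cat (Span C S) (z_rel C S)"

text \<open>The functor \<open>C \<rightarrow> Retr C S\<close> that fixes objects and sends \<open>f\<close> to the class of \<open>(1, f)\<close>.\<close>

definition retr_functor ::
    "('o, 'a) cat \<Rightarrow> 'a set \<Rightarrow> ('o, 'a, 'o, ('a \<times> 'a) set set) func" where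
  "retr_functor C S = \<lparr>
     omap = (\<lambda>A. A),
     amap = (\<lambda>f. z_rel C S `` {span_class C S (Idt C (Dom C f), f)})\<rparr>"

end

theory Submission
  imports Defs
begin

text \<open>In the quotient, the class of \<open>(s, 1)\<close> is inverse to the class of \<open>(1, s)\<close>: one composite is
  \<open>(s, s)\<close>, which \<open>s\<close> itself relates to \<open>(1, 1)\<close>, and the other is \<open>(1, 1)\<close> because the kernel pair
  of a monomorphism is trivial. Since every class factors as \<open>(s, f) = (1, f) \<cdot> (s, 1)\<close>, a functor \<open>F\<close>
  inverting \<open>S\<close> can only be extended by \<open>(s, f) \<mapsto> F f \<cdot> (F s)\<^sup>-\<^sup>1\<close>. This respects \<open>\<sim>\<^sub>z\<close> since \<open>F x\<close> cancels for
  \<open>x \<in> S\<close>, and it respects composition since \<open>f \<cdot> t' = t \<cdot> f'\<close> gives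
  \<open>(F t)\<^sup>-\<^sup>1 \<cdot> F f = F f' \<cdot> (F t')\<^sup>-\<^sup>1\<close>. That composition respects \<open>\<sim>\<^sub>z\<close> comes from pasting of pullbacks: the
  morphism induced between two composites is itself composed of pullbacks of the given ones.\<close>

section \<open>Isomorphisms and pullbacks\<close>

context category
begin

section \<open>Rewriting rules and two-sided inverses\<close>

lemmas cat_simps = Dom_closed Cod_closed Idt_closed Dom_Idt Cod_Idt Comp_closed Dom_Comp Cod_Comp
  Comp_assoc

text \<open>The object is tied to \<open>f\<close> by an equation, so the rule also applies when the
  identity is indexed by an object that is only provably the codomain.\<close>

lemma Idt_Comp': "f \<in> Arr C \<Longrightarrow> A = Cod C f \<Longrightarrow> Idt C A \<cdot>\<^bsub>C\<^esub> f = f"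
  by (simp add: Idt_Comp)

lemma Comp_Idt': "f \<in> Arr C \<Longrightarrow> A = Dom C f \<Longrightarrow> f \<cdot>\<^bsub>C\<^esub> Idt C A = f"
  by (simp add: Comp_Idt)

text \<open>The inverse is an explicit argument instead of being hidden under an existential, so
  that inverses can be compared, composed and transported by functors.\<close>

definition inverse_of :: "'a \<Rightarrow> 'a \<Rightarrow> bool" where
  "inverse_of f g \<longleftrightarrow> f \<in> Arr C \<and> g \<in> Arr C \<and> Dom C g = Cod C f \<and> Cod C g = Dom C f \<and>
     g \<cdot>\<^bsub>C\<^esub> f = Idt C (Dom C f) \<and> f \<cdot>\<^bsub>C\<^esub> g = Idt C (Cod C f)"

lemma isomorphism_iff_inverse_of: "isomorphism C f \<longleftrightarrow> (\<exists>g. inverse_of f g)"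
  unfolding isomorphism_def inverse_of_def by blast

lemma inverse_of_sym: "inverse_of f g \<Longrightarrow> inverse_of g f"
  unfolding inverse_of_def by auto

lemma inverse_of_cancel:
  assumes "inverse_of f g" "h \<in> Arr C" "Cod C h = Dom C f"
  shows "g \<cdot>\<^bsub>C\<^esub> (f \<cdot>\<^bsub>C\<^esub> h) = h"
proof -
  have "g \<cdot>\<^bsub>C\<^esub> (f \<cdot>\<^bsub>C\<^esub> h) = (g \<cdot>\<^bsub>C\<^esub> f) \<cdot>\<^bsub>C\<^esub> h"
    using assms unfolding inverse_of_def by (metis Comp_assoc)
  then show ?thesis
    using assms by (simp add: inverse_of_def Idt_Comp')
qed

text \<open>The product \<open>g \<cdot> f \<cdot> h\<close> reduces to \<open>h\<close> from the
  left and to \<open>g\<close> from the right.\<close>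

lemma inverse_of_unique:
  assumes "inverse_of f g" "inverse_of f h"
  shows "g = h"
proof -
  have "g \<cdot>\<^bsub>C\<^esub> (f \<cdot>\<^bsub>C\<^esub> h) = h"
    using assms by (intro inverse_of_cancel) (simp_all add: inverse_of_def)
  then show ?thesis
    using assms Comp_Idt[of g] unfolding inverse_of_def by metis
qed

lemma inverse_of_Idt: "A \<in> Obj C \<Longrightarrow> inverse_of (Idt C A) (Idt C A)"
  by (simp add: inverse_of_def cat_simps Idt_Comp')

lemma inverse_of_Comp:
  assumes f: "inverse_of f f'" and g: "inverse_of g g'" and fg: "Dom C g = Cod C f"
  shows "inverse_of (g \<cdot>\<^bsub>C\<^esub> f) (f' \<cdot>\<^bsub>C\<^esub> g')"
proof -
  note A = f[unfolded inverse_of_def] g[unfolded inverse_of_def]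
  have "(f' \<cdot>\<^bsub>C\<^esub> g') \<cdot>\<^bsub>C\<^esub> (g \<cdot>\<^bsub>C\<^esub> f) = f' \<cdot>\<^bsub>C\<^esub> (g' \<cdot>\<^bsub>C\<^esub> (g \<cdot>\<^bsub>C\<^esub> f))"
    using A fg by (intro Comp_assoc) (simp_all add: Comp_closed Cod_Comp)
  moreover have "(g \<cdot>\<^bsub>C\<^esub> f) \<cdot>\<^bsub>C\<^esub> (f' \<cdot>\<^bsub>C\<^esub> g') = g \<cdot>\<^bsub>C\<^esub> (f \<cdot>\<^bsub>C\<^esub> (f' \<cdot>\<^bsub>C\<^esub> g'))"
    using A fg by (intro Comp_assoc) (simp_all add: Comp_closed Cod_Comp)
  moreover have "g' \<cdot>\<^bsub>C\<^esub> (g \<cdot>\<^bsub>C\<^esub> f) = f" "f \<cdot>\<^bsub>C\<^esub> (f' \<cdot>\<^bsub>C\<^esub> g') = g'"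
    using A fg inverse_of_cancel[OF g] inverse_of_cancel[OF inverse_of_sym[OF f]] by simp_all
  ultimately show ?thesis
    using A fg by (simp add: inverse_of_def Comp_closed Dom_Comp Cod_Comp)
qed

lemma isomorphism_Comp:
  "isomorphism C f \<Longrightarrow> isomorphism C g \<Longrightarrow> Dom C g = Cod C f \<Longrightarrow> isomorphism C (g \<cdot>\<^bsub>C\<^esub> f)"
  unfolding isomorphism_iff_inverse_of by (blast intro: inverse_of_Comp)

section \<open>Pullback squares: lifting, pasting and cancellation\<close>

lemma is_pullbackD:
  assumes "is_pullback C f t t' f'"
  shows "f \<in> Arr C" "t \<in> Arr C" "t' \<in> Arr C" "f' \<in> Arr C"
    "Cod C f = Cod C t" "Dom C t' = Dom C f'" "Cod C t' = Dom C f" "Cod C f' = Dom C t"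
    "f \<cdot>\<^bsub>C\<^esub> t' = t \<cdot>\<^bsub>C\<^esub> f'"
  using assms unfolding is_pullback_def by auto

lemma is_pullback_ex1:
  assumes "is_pullback C f t t' f'"
    and "u \<in> Arr C" "v \<in> Arr C" "Dom C u = Dom C v" "Cod C u = Dom C f" "Cod C v = Dom C t"
      "f \<cdot>\<^bsub>C\<^esub> u = t \<cdot>\<^bsub>C\<^esub> v"
  shows "\<exists>!w. w \<in> Arr C \<and> Dom C w = Dom C u \<and> Cod C w = Dom C t' \<and>
    t' \<cdot>\<^bsub>C\<^esub> w = u \<and> f' \<cdot>\<^bsub>C\<^esub> w = v"
  using assms unfolding is_pullback_def by blast

lemma is_pullback_lift:
  assumes "is_pullback C f t t' f'"
    and "u \<in> Arr C" "v \<in> Arr C" "Dom C u = Dom C v" "Cod C u = Dom C f" "Cod C v = Dom C t"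
      "f \<cdot>\<^bsub>C\<^esub> u = t \<cdot>\<^bsub>C\<^esub> v"
  obtains w where "w \<in> Arr C" "Dom C w = Dom C u" "Cod C w = Dom C t'"
    "t' \<cdot>\<^bsub>C\<^esub> w = u" "f' \<cdot>\<^bsub>C\<^esub> w = v"
  using is_pullback_ex1[OF assms] by blast

text \<open>The two projections of a pullback are jointly monic: \<open>w\<close> and
  \<open>z\<close> both mediate the cone formed by \<open>t' \<cdot> z\<close> and
  \<open>f' \<cdot> z\<close>.\<close>

lemma is_pullback_eqI:
  assumes pb: "is_pullback C f t t' f'"
    and w: "w \<in> Arr C" "Cod C w = Dom C t'" and z: "z \<in> Arr C" "Cod C z = Dom C t'"
    and dom: "Dom C w = Dom C z"
    and eq: "t' \<cdot>\<^bsub>C\<^esub> w = t' \<cdot>\<^bsub>C\<^esub> z" "f' \<cdot>\<^bsub>C\<^esub> w = f' \<cdot>\<^bsub>C\<^esub> z"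
  shows "w = z"
proof -
  note D = is_pullbackD[OF pb]
  let ?u = "t' \<cdot>\<^bsub>C\<^esub> z" and ?v = "f' \<cdot>\<^bsub>C\<^esub> z"
  have "f \<cdot>\<^bsub>C\<^esub> ?u = t \<cdot>\<^bsub>C\<^esub> ?v"
    using D z by (metis Comp_assoc)
  moreover have uv: "?u \<in> Arr C" "?v \<in> Arr C" "Dom C ?u = Dom C z" "Dom C ?v = Dom C z"
    "Cod C ?u = Dom C f" "Cod C ?v = Dom C t"
    using D z by (simp_all add: Comp_closed Dom_Comp Cod_Comp)
  ultimately have "\<exists>!w. w \<in> Arr C \<and> Dom C w = Dom C ?u \<and> Cod C w = Dom C t' \<and>
      t' \<cdot>\<^bsub>C\<^esub> w = ?u \<and> f' \<cdot>\<^bsub>C\<^esub> w = ?v"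
    by (intro is_pullback_ex1[OF pb]) simp_all
  then obtain k where k: "x = k" if "x \<in> Arr C" "Dom C x = Dom C ?u" "Cod C x = Dom C t'"
      "t' \<cdot>\<^bsub>C\<^esub> x = ?u" "f' \<cdot>\<^bsub>C\<^esub> x = ?v" for x
    by (elim ex1E) blast
  from k[of w] k[of z] show ?thesis
    using w z dom eq uv(3) by simp
qed

text \<open>Unique existence is split into a lift and joint monicity of the projections, two facts
  that the proofs below establish separately.\<close>

lemma is_pullbackI:
  assumes "f \<in> Arr C" "t \<in> Arr C" "t' \<in> Arr C" "f' \<in> Arr C"
    "Cod C f = Cod C t" "Dom C t' = Dom C f'" "Cod C t' = Dom C f" "Cod C f' = Dom C t"
    "f \<cdot>\<^bsub>C\<^esub> t' = t \<cdot>\<^bsub>C\<^esub> f'"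
    and lift: "\<And>u v. u \<in> Arr C \<Longrightarrow> v \<in> Arr C \<Longrightarrow> Dom C u = Dom C v \<Longrightarrow> Cod C u = Dom C f \<Longrightarrow>
      Cod C v = Dom C t \<Longrightarrow> f \<cdot>\<^bsub>C\<^esub> u = t \<cdot>\<^bsub>C\<^esub> v \<Longrightarrow>
      \<exists>w. w \<in> Arr C \<and> Dom C w = Dom C u \<and> Cod C w = Dom C t' \<and> t' \<cdot>\<^bsub>C\<^esub> w = u \<and> f' \<cdot>\<^bsub>C\<^esub> w = v"
    and unique: "\<And>w z. w \<in> Arr C \<Longrightarrow> z \<in> Arr C \<Longrightarrow> Cod C w = Dom C t' \<Longrightarrow> Cod C z = Dom C t' \<Longrightarrow>
      Dom C w = Dom C z \<Longrightarrow> t' \<cdot>\<^bsub>C\<^esub> w = t' \<cdot>\<^bsub>C\<^esub> z \<Longrightarrow> f' \<cdot>\<^bsub>C\<^esub> w = f' \<cdot>\<^bsub>C\<^esub> z \<Longrightarrow> w = z"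
  shows "is_pullback C f t t' f'"
  unfolding is_pullback_def
proof (intro conjI ballI impI)
  fix u v assume "u \<in> Arr C" "v \<in> Arr C" "Dom C u = Dom C v" "Cod C u = Dom C f"
    "Cod C v = Dom C t" "f \<cdot>\<^bsub>C\<^esub> u = t \<cdot>\<^bsub>C\<^esub> v"
  from lift[OF this] unique
  show "\<exists>!w. w \<in> Arr C \<and> Dom C w = Dom C u \<and> Cod C w = Dom C t' \<and> t' \<cdot>\<^bsub>C\<^esub> w = u \<and> f' \<cdot>\<^bsub>C\<^esub> w = v"
    by (intro ex_ex1I) auto
qed (use assms in auto)

lemma is_pullback_sym:
  assumes pb: "is_pullback C f t t' f'"
  shows "is_pullback C t f f' t'"
proof (rule is_pullbackI)
  note D = is_pullbackD[OF pb]
  fix u v assume "u \<in> Arr C" "v \<in> Arr C" "Dom C u = Dom C v" "Cod C u = Dom C t"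
    "Cod C v = Dom C f" "t \<cdot>\<^bsub>C\<^esub> u = f \<cdot>\<^bsub>C\<^esub> v"
  then show "\<exists>w. w \<in> Arr C \<and> Dom C w = Dom C u \<and> Cod C w = Dom C f' \<and> f' \<cdot>\<^bsub>C\<^esub> w = u \<and> t' \<cdot>\<^bsub>C\<^esub> w = v"
    using is_pullback_lift[OF pb, of v u] D by metis
next
  fix w z assume "w \<in> Arr C" "z \<in> Arr C" "Cod C w = Dom C f'" "Cod C z = Dom C f'"
    "Dom C w = Dom C z" "f' \<cdot>\<^bsub>C\<^esub> w = f' \<cdot>\<^bsub>C\<^esub> z" "t' \<cdot>\<^bsub>C\<^esub> w = t' \<cdot>\<^bsub>C\<^esub> z"
  then show "w = z"
    using is_pullbackD(6)[OF pb] by - (rule is_pullback_eqI[OF pb]; simp)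
qed (simp_all add: is_pullbackD[OF pb])

text \<open>A cone here satisfies \<open>f \<cdot> u = v\<close>, so \<open>u\<close> itself is the
  mediating arrow.\<close>

lemma is_pullback_Idt:
  assumes "f \<in> Arr C"
  shows "is_pullback C f (Idt C (Cod C f)) (Idt C (Dom C f)) f"
proof (rule is_pullbackI)
  fix u v assume "u \<in> Arr C" "v \<in> Arr C" "Dom C u = Dom C v" "Cod C u = Dom C f"
    "Cod C v = Dom C (Idt C (Cod C f))" "f \<cdot>\<^bsub>C\<^esub> u = Idt C (Cod C f) \<cdot>\<^bsub>C\<^esub> v"
  then show "\<exists>w. w \<in> Arr C \<and> Dom C w = Dom C u \<and> Cod C w = Dom C (Idt C (Dom C f)) \<and>
      Idt C (Dom C f) \<cdot>\<^bsub>C\<^esub> w = u \<and> f \<cdot>\<^bsub>C\<^esub> w = v"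
    using assms by (intro exI[of _ u]) (simp add: cat_simps Idt_Comp')
qed (use assms in \<open>simp_all add: cat_simps Idt_Comp' Comp_Idt'\<close>)

text \<open>The kernel pair is trivial: a cone consists of two equal arrows, and that arrow
  mediates. This is how monicity enters the construction of inverses.\<close>

lemma monomorphism_is_pullback:
  assumes "monomorphism C m"
  shows "is_pullback C m m (Idt C (Dom C m)) (Idt C (Dom C m))"
proof (rule is_pullbackI)
  have m: "m \<in> Arr C"
    using assms by (simp add: monomorphism_def)
  fix u v assume uv: "u \<in> Arr C" "v \<in> Arr C" "Dom C u = Dom C v" "Cod C u = Dom C m"
    "Cod C v = Dom C m" "m \<cdot>\<^bsub>C\<^esub> u = m \<cdot>\<^bsub>C\<^esub> v"
  then have "u = v"
    using assms unfolding monomorphism_def by metis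
  then show "\<exists>w. w \<in> Arr C \<and> Dom C w = Dom C u \<and> Cod C w = Dom C (Idt C (Dom C m)) \<and>
      Idt C (Dom C m) \<cdot>\<^bsub>C\<^esub> w = u \<and> Idt C (Dom C m) \<cdot>\<^bsub>C\<^esub> w = v"
    using uv m by (intro exI[of _ u]) (simp add: cat_simps Idt_Comp')
qed (use assms in \<open>simp_all add: monomorphism_def cat_simps Idt_Comp'\<close>)

text \<open>Lifting is done in two stages, first into the square on \<open>f\<close> and
  \<open>t\<close>, then into the one on \<open>f'\<close> and \<open>r\<close>. Uniqueness uses
  joint monicity once in each square.\<close>

lemma is_pullback_paste:
  assumes pb: "is_pullback C f t t' f'" and pb': "is_pullback C f' r r' f''"
  shows "is_pullback C f (t \<cdot>\<^bsub>C\<^esub> r) (t' \<cdot>\<^bsub>C\<^esub> r') f''"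
proof (rule is_pullbackI)
  note D = is_pullbackD[OF pb] is_pullbackD[OF pb']
  have "f \<cdot>\<^bsub>C\<^esub> (t' \<cdot>\<^bsub>C\<^esub> r') = t \<cdot>\<^bsub>C\<^esub> (f' \<cdot>\<^bsub>C\<^esub> r')"
    using D by (metis Comp_assoc)
  then show "f \<cdot>\<^bsub>C\<^esub> (t' \<cdot>\<^bsub>C\<^esub> r') = (t \<cdot>\<^bsub>C\<^esub> r) \<cdot>\<^bsub>C\<^esub> f''"
    using D by (simp add: Comp_assoc)
  show "f \<in> Arr C" "t \<cdot>\<^bsub>C\<^esub> r \<in> Arr C" "t' \<cdot>\<^bsub>C\<^esub> r' \<in> Arr C" "f'' \<in> Arr C"
    "Cod C f = Cod C (t \<cdot>\<^bsub>C\<^esub> r)" "Dom C (t' \<cdot>\<^bsub>C\<^esub> r') = Dom C f''"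
    "Cod C (t' \<cdot>\<^bsub>C\<^esub> r') = Dom C f" "Cod C f'' = Dom C (t \<cdot>\<^bsub>C\<^esub> r)"
    using D by (simp_all add: Comp_closed Dom_Comp Cod_Comp)
next
  note D = is_pullbackD[OF pb] is_pullbackD[OF pb']
  fix u v assume u: "u \<in> Arr C" and v: "v \<in> Arr C" and uv: "Dom C u = Dom C v"
    and cu: "Cod C u = Dom C f" and cv: "Cod C v = Dom C (t \<cdot>\<^bsub>C\<^esub> r)"
    and eq: "f \<cdot>\<^bsub>C\<^esub> u = (t \<cdot>\<^bsub>C\<^esub> r) \<cdot>\<^bsub>C\<^esub> v"
  have cv': "Cod C v = Dom C r"
    using cv D by (simp add: Dom_Comp)
  have "f \<cdot>\<^bsub>C\<^esub> u = t \<cdot>\<^bsub>C\<^esub> (r \<cdot>\<^bsub>C\<^esub> v)"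
    using eq D v cv' by (simp add: Comp_assoc)
  then obtain w where w: "w \<in> Arr C" "Dom C w = Dom C u" "Cod C w = Dom C t'"
      "t' \<cdot>\<^bsub>C\<^esub> w = u" "f' \<cdot>\<^bsub>C\<^esub> w = r \<cdot>\<^bsub>C\<^esub> v"
    using is_pullback_lift[OF pb, of u "r \<cdot>\<^bsub>C\<^esub> v"] D u v uv cu cv'
    by (auto simp: Comp_closed Dom_Comp Cod_Comp)
  then obtain z where z: "z \<in> Arr C" "Dom C z = Dom C w" "Cod C z = Dom C r'"
      "r' \<cdot>\<^bsub>C\<^esub> z = w" "f'' \<cdot>\<^bsub>C\<^esub> z = v"
    using is_pullback_lift[OF pb', of w v] D v uv cv' by auto
  then show "\<exists>w. w \<in> Arr C \<and> Dom C w = Dom C u \<and> Cod C w = Dom C (t' \<cdot>\<^bsub>C\<^esub> r') \<and>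
      (t' \<cdot>\<^bsub>C\<^esub> r') \<cdot>\<^bsub>C\<^esub> w = u \<and> f'' \<cdot>\<^bsub>C\<^esub> w = v"
    using D w by (intro exI[of _ z]) (simp add: Dom_Comp Comp_assoc)
next
  note D = is_pullbackD[OF pb] is_pullbackD[OF pb']
  fix w z assume wz: "w \<in> Arr C" "z \<in> Arr C" "Cod C w = Dom C (t' \<cdot>\<^bsub>C\<^esub> r')"
    "Cod C z = Dom C (t' \<cdot>\<^bsub>C\<^esub> r')" "Dom C w = Dom C z"
    and eq: "(t' \<cdot>\<^bsub>C\<^esub> r') \<cdot>\<^bsub>C\<^esub> w = (t' \<cdot>\<^bsub>C\<^esub> r') \<cdot>\<^bsub>C\<^esub> z" "f'' \<cdot>\<^bsub>C\<^esub> w = f'' \<cdot>\<^bsub>C\<^esub> z"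
  have cwz: "Cod C w = Dom C r'" "Cod C z = Dom C r'"
    using wz D by (simp_all add: Dom_Comp)
  have "f' \<cdot>\<^bsub>C\<^esub> (r' \<cdot>\<^bsub>C\<^esub> w) = f' \<cdot>\<^bsub>C\<^esub> (r' \<cdot>\<^bsub>C\<^esub> z)"
    using D wz cwz eq by (metis Comp_assoc)
  moreover have "t' \<cdot>\<^bsub>C\<^esub> (r' \<cdot>\<^bsub>C\<^esub> w) = t' \<cdot>\<^bsub>C\<^esub> (r' \<cdot>\<^bsub>C\<^esub> z)"
    using eq D wz cwz by (simp add: Comp_assoc)
  ultimately have "r' \<cdot>\<^bsub>C\<^esub> w = r' \<cdot>\<^bsub>C\<^esub> z"
    using D wz cwz by - (rule is_pullback_eqI[OF pb]; simp add: Comp_closed Dom_Comp Cod_Comp)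
  then show "w = z"
    using wz cwz eq by - (rule is_pullback_eqI[OF pb']; simp)
qed

text \<open>The cancellation half of the pasting law, which also constructs the comparison arrow
  \<open>y\<close>. It presents \<open>y\<close> as a pullback of \<open>x\<close> and thereby
  places \<open>y\<close> in any pullback-stable class containing \<open>x\<close>.\<close>

lemma is_pullback_cancel:
  assumes pb: "is_pullback C f t u v" and x: "x \<in> Arr C" "Cod C x = Dom C f"
    and pb': "is_pullback C (f \<cdot>\<^bsub>C\<^esub> x) t t' f'"
  obtains y where "y \<in> Arr C" "Dom C y = Dom C t'" "Cod C y = Dom C u"
    "u \<cdot>\<^bsub>C\<^esub> y = x \<cdot>\<^bsub>C\<^esub> t'" "v \<cdot>\<^bsub>C\<^esub> y = f'" "is_pullback C u x y t'"
proof -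
  note D = is_pullbackD[OF pb] is_pullbackD[OF pb']
  have t': "Cod C t' = Dom C x"
    using D x by (simp add: Dom_Comp)
  have eq: "f \<cdot>\<^bsub>C\<^esub> (x \<cdot>\<^bsub>C\<^esub> t') = t \<cdot>\<^bsub>C\<^esub> f'"
    using D x t' by (metis Comp_assoc)
  obtain y where y: "y \<in> Arr C" "Dom C y = Dom C (x \<cdot>\<^bsub>C\<^esub> t')" "Cod C y = Dom C u"
      "u \<cdot>\<^bsub>C\<^esub> y = x \<cdot>\<^bsub>C\<^esub> t'" "v \<cdot>\<^bsub>C\<^esub> y = f'"
    using is_pullback_lift[OF pb, of "x \<cdot>\<^bsub>C\<^esub> t'" f'] D x t' eq
    by (auto simp: Comp_closed Dom_Comp Cod_Comp)
  have dy: "Dom C y = Dom C t'"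
    using y D x t' by (simp add: Dom_Comp)
  have "is_pullback C u x y t'"
  proof (rule is_pullbackI)
    fix a b assume a: "a \<in> Arr C" "Cod C a = Dom C u" and b: "b \<in> Arr C" "Cod C b = Dom C x"
      and ab: "Dom C a = Dom C b" and e: "u \<cdot>\<^bsub>C\<^esub> a = x \<cdot>\<^bsub>C\<^esub> b"
    \<comment> \<open>The arrow \<open>v \<cdot> a\<close> completes \<open>b\<close> to a cone over
      \<open>f \<cdot> x\<close> and \<open>t\<close>; its lift \<open>w\<close> is the required
      mediating arrow.\<close>
    have "f \<cdot>\<^bsub>C\<^esub> (x \<cdot>\<^bsub>C\<^esub> b) = t \<cdot>\<^bsub>C\<^esub> (v \<cdot>\<^bsub>C\<^esub> a)"
      using D a e by (metis Comp_assoc)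
    then have "(f \<cdot>\<^bsub>C\<^esub> x) \<cdot>\<^bsub>C\<^esub> b = t \<cdot>\<^bsub>C\<^esub> (v \<cdot>\<^bsub>C\<^esub> a)"
      using D x b by (simp add: Comp_assoc)
    then obtain w where w: "w \<in> Arr C" "Dom C w = Dom C b" "Cod C w = Dom C t'"
        "t' \<cdot>\<^bsub>C\<^esub> w = b" "f' \<cdot>\<^bsub>C\<^esub> w = v \<cdot>\<^bsub>C\<^esub> a"
      using is_pullback_lift[OF pb', of b "v \<cdot>\<^bsub>C\<^esub> a"] D x a b ab
      by (auto simp: Comp_closed Dom_Comp Cod_Comp)
    have "u \<cdot>\<^bsub>C\<^esub> (y \<cdot>\<^bsub>C\<^esub> w) = u \<cdot>\<^bsub>C\<^esub> a"
    proof -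
      have "u \<cdot>\<^bsub>C\<^esub> (y \<cdot>\<^bsub>C\<^esub> w) = (x \<cdot>\<^bsub>C\<^esub> t') \<cdot>\<^bsub>C\<^esub> w"
        using D y dy w by (metis Comp_assoc)
      also have "\<dots> = u \<cdot>\<^bsub>C\<^esub> a"
        using D x t' w e by (simp add: Comp_assoc)
      finally show ?thesis .
    qed
    moreover have "v \<cdot>\<^bsub>C\<^esub> (y \<cdot>\<^bsub>C\<^esub> w) = v \<cdot>\<^bsub>C\<^esub> a"
      using D y dy w by (metis Comp_assoc)
    ultimately have "y \<cdot>\<^bsub>C\<^esub> w = a"
      using a(1,2) w(1-3) ab y(1,3) dy
      by - (rule is_pullback_eqI[OF pb]; simp add: Comp_closed Dom_Comp Cod_Comp)
    then show "\<exists>w. w \<in> Arr C \<and> Dom C w = Dom C a \<and> Cod C w = Dom C y \<and> y \<cdot>\<^bsub>C\<^esub> w = a \<and> t' \<cdot>\<^bsub>C\<^esub> w = b"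
      using w ab dy by auto
  next
    fix w z assume wz: "w \<in> Arr C" "z \<in> Arr C" "Cod C w = Dom C y" "Cod C z = Dom C y"
      "Dom C w = Dom C z" "y \<cdot>\<^bsub>C\<^esub> w = y \<cdot>\<^bsub>C\<^esub> z" "t' \<cdot>\<^bsub>C\<^esub> w = t' \<cdot>\<^bsub>C\<^esub> z"
    \<comment> \<open>Since \<open>f'\<close> factors through \<open>y\<close>, agreement after
      \<open>y\<close> gives agreement after \<open>f'\<close>.\<close>
    have "f' \<cdot>\<^bsub>C\<^esub> h = v \<cdot>\<^bsub>C\<^esub> (y \<cdot>\<^bsub>C\<^esub> h)" if "h \<in> Arr C" "Cod C h = Dom C y" for h
      unfolding y(5)[symmetric] using that D(4,6) y(1,3) by (intro Comp_assoc) simp_all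
    then have "f' \<cdot>\<^bsub>C\<^esub> w = f' \<cdot>\<^bsub>C\<^esub> z"
      using wz by simp
    then show "w = z"
      using wz dy by - (rule is_pullback_eqI[OF pb']; simp)
  qed (use D(3,7,12) x y(1,3,4) dy t' in simp_all)
  with y dy show thesis
    using that by blast
qed

text \<open>The inverse of \<open>t'\<close> is the lift of the cone made of an identity and
  \<open>s \<cdot> f\<close>, where \<open>s\<close> is inverse to \<open>t\<close>. One inverse law
  holds by construction, the other by joint monicity.\<close>

lemma isomorphism_is_pullback:
  assumes iso: "isomorphism C t" and pb: "is_pullback C f t t' f'"
  shows "isomorphism C t'"
proof -
  note D = is_pullbackD[OF pb]
  obtain s where s: "inverse_of t s"
    using iso isomorphism_iff_inverse_of by blast
  note I = s[unfolded inverse_of_def]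
  have "f \<cdot>\<^bsub>C\<^esub> Idt C (Dom C f) = t \<cdot>\<^bsub>C\<^esub> (s \<cdot>\<^bsub>C\<^esub> f)"
  proof -
    have "t \<cdot>\<^bsub>C\<^esub> (s \<cdot>\<^bsub>C\<^esub> f) = (t \<cdot>\<^bsub>C\<^esub> s) \<cdot>\<^bsub>C\<^esub> f"
      using I D by (metis Comp_assoc)
    then show ?thesis
      using I D by (simp add: Idt_Comp' Comp_Idt')
  qed
  then obtain w where w: "w \<in> Arr C" "Dom C w = Dom C f" "Cod C w = Dom C t'"
      "t' \<cdot>\<^bsub>C\<^esub> w = Idt C (Dom C f)" "f' \<cdot>\<^bsub>C\<^esub> w = s \<cdot>\<^bsub>C\<^esub> f"
    using is_pullback_lift[OF pb, of "Idt C (Dom C f)" "s \<cdot>\<^bsub>C\<^esub> f"] D I by (auto simp: cat_simps)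
  have "t' \<cdot>\<^bsub>C\<^esub> (w \<cdot>\<^bsub>C\<^esub> t') = t'"
  proof -
    have "t' \<cdot>\<^bsub>C\<^esub> (w \<cdot>\<^bsub>C\<^esub> t') = (t' \<cdot>\<^bsub>C\<^esub> w) \<cdot>\<^bsub>C\<^esub> t'"
      using w D by (metis Comp_assoc)
    then show ?thesis
      using w D by (simp add: Idt_Comp')
  qed
  moreover have "f' \<cdot>\<^bsub>C\<^esub> (w \<cdot>\<^bsub>C\<^esub> t') = f'"
  proof -
    have "f' \<cdot>\<^bsub>C\<^esub> (w \<cdot>\<^bsub>C\<^esub> t') = (s \<cdot>\<^bsub>C\<^esub> f) \<cdot>\<^bsub>C\<^esub> t'"
      using w D by (metis Comp_assoc)
    also have "\<dots> = s \<cdot>\<^bsub>C\<^esub> (t \<cdot>\<^bsub>C\<^esub> f')"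
      using D I by (simp add: Comp_assoc)
    also have "\<dots> = (s \<cdot>\<^bsub>C\<^esub> t) \<cdot>\<^bsub>C\<^esub> f'"
      using D I by (metis Comp_assoc)
    finally show ?thesis
      using D I by (simp add: Idt_Comp')
  qed
  ultimately have "w \<cdot>\<^bsub>C\<^esub> t' = Idt C (Dom C t')"
    using D w by - (rule is_pullback_eqI[OF pb]; simp add: cat_simps Comp_Idt')
  then have "inverse_of t' w"
    using D w by (simp add: inverse_of_def)
  then show ?thesis
    using isomorphism_iff_inverse_of by blast
qed

end

section \<open>Composition of spans\<close>

lemma span_mor_Comp:
  assumes "category C" "span_mor C p q x" "span_mor C q r y" "fst r \<in> Arr C" "snd r \<in> Arr C"
    "Dom C (snd r) = Dom C (fst r)"
  shows "span_mor C p r (y \<cdot>\<^bsub>C\<^esub> x)"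
proof -
  interpret category C by fact
  have "fst r \<cdot>\<^bsub>C\<^esub> (y \<cdot>\<^bsub>C\<^esub> x) = (fst r \<cdot>\<^bsub>C\<^esub> y) \<cdot>\<^bsub>C\<^esub> x"
    and "snd r \<cdot>\<^bsub>C\<^esub> (y \<cdot>\<^bsub>C\<^esub> x) = (snd r \<cdot>\<^bsub>C\<^esub> y) \<cdot>\<^bsub>C\<^esub> x"
    using assms(2-) by (simp_all add: span_mor_def Comp_assoc[symmetric])
  then show ?thesis
    using assms(2-) by (simp add: span_mor_def Comp_closed Dom_Comp Cod_Comp)
qed

section \<open>Isomorphism of spans and comparison of composites\<close>

context span_base
begin

lemma S_in_Arr: "s \<in> S \<Longrightarrow> s \<in> Arr C"
  using S_Arr by blast

lemma Idt_in_S: "A \<in> Obj C \<Longrightarrow> Idt C A \<in> S"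
  using S_iso inverse_of_Idt isomorphism_iff_inverse_of by blast

lemma spans_iff [simp]: "(s, f) \<in> spans C S \<longleftrightarrow> s \<in> S \<and> f \<in> Arr C \<and> Dom C s = Dom C f"
  by (simp add: spans_def)

lemma spansD:
  assumes "p \<in> spans C S"
  shows "fst p \<in> S" "fst p \<in> Arr C" "snd p \<in> Arr C" "Dom C (snd p) = Dom C (fst p)"
  using assms S_in_Arr by (auto simp: spans_def)

lemma span_mor_Idt:
  "p \<in> spans C S \<Longrightarrow> span_mor C p p (Idt C (Dom C (fst p)))"
  by (frule spansD(2), frule spansD(3), frule spansD(4))
    (simp add: span_mor_def cat_simps Comp_Idt')

lemma span_mor_Cod:
  assumes "span_mor C p q x" "q \<in> spans C S"
  shows "Cod C (fst p) = Cod C (fst q)" "Cod C (snd p) = Cod C (snd q)"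
  using assms(1) Cod_Comp[of x "fst q"] Cod_Comp[of x "snd q"] spansD(2-4)[OF assms(2)]
  by (auto simp: span_mor_def)

text \<open>Isomorphisms lie in \<open>S\<close>, which supplies their pullbacks, and they are
  stable under pullback. The comparison of composites can thus be proved once for a general class
  and used both for \<open>S\<close> and for isomorphisms.\<close>

lemma span_base_isomorphisms: "span_base C {f. isomorphism C f}"
proof unfold_locales
  show "{f. isomorphism C f} \<subseteq> Arr C"
    by (auto simp: isomorphism_def)
  show "t' \<in> {f. isomorphism C f}" if "t \<in> {f. isomorphism C f}" "is_pullback C f t t' f'"
    for t f t' f'
    using that isomorphism_is_pullback by simp
qed (use S_iso S_pullback_ex isomorphism_Comp in auto)

text \<open>An inverse \<open>y\<close> of a span morphism \<open>x\<close> is again a span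
  morphism, since \<open>fst p \<cdot> y = fst q \<cdot> x \<cdot> y = fst q\<close>, and likewise
  for the second legs. So a single invertible morphism suffices.\<close>

lemma span_iso_iff:
  "(p, q) \<in> span_iso C S \<longleftrightarrow>
    p \<in> spans C S \<and> q \<in> spans C S \<and> (\<exists>x. isomorphism C x \<and> span_mor C p q x)"
proof
  assume "(p, q) \<in> span_iso C S"
  then show "p \<in> spans C S \<and> q \<in> spans C S \<and> (\<exists>x. isomorphism C x \<and> span_mor C p q x)"
    unfolding span_iso_def isomorphism_iff_inverse_of inverse_of_def span_mor_def by fastforce
next
  assume R: "p \<in> spans C S \<and> q \<in> spans C S \<and> (\<exists>x. isomorphism C x \<and> span_mor C p q x)"
  then obtain x y where x: "span_mor C p q x" and xy: "inverse_of x y"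
    unfolding isomorphism_iff_inverse_of by blast
  have q: "q \<in> spans C S"
    using R by blast
  have D: "Dom C x = Dom C (fst p)" "Cod C x = Dom C (fst q)"
    using x by (simp_all add: span_mor_def)
  have "fst q \<cdot>\<^bsub>C\<^esub> (x \<cdot>\<^bsub>C\<^esub> y) = (fst q \<cdot>\<^bsub>C\<^esub> x) \<cdot>\<^bsub>C\<^esub> y"
    and "snd q \<cdot>\<^bsub>C\<^esub> (x \<cdot>\<^bsub>C\<^esub> y) = (snd q \<cdot>\<^bsub>C\<^esub> x) \<cdot>\<^bsub>C\<^esub> y"
    by (rule Comp_assoc[symmetric]; use x xy spansD[OF q] in \<open>simp add: span_mor_def inverse_of_def\<close>)+
  then have "fst q \<cdot>\<^bsub>C\<^esub> (x \<cdot>\<^bsub>C\<^esub> y) = fst p \<cdot>\<^bsub>C\<^esub> y" "snd q \<cdot>\<^bsub>C\<^esub> (x \<cdot>\<^bsub>C\<^esub> y) = snd p \<cdot>\<^bsub>C\<^esub> y"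
    using x by (simp_all add: span_mor_def)
  then have "span_mor C q p y"
    using xy D spansD[OF q] by (simp add: span_mor_def inverse_of_def Comp_Idt')
  then show "(p, q) \<in> span_iso C S"
    using R x xy D unfolding span_iso_def inverse_of_def by auto
qed

lemma equiv_span_iso: "equiv (spans C S) (span_iso C S)"
proof (rule equivI)
  show "span_iso C S \<subseteq> spans C S \<times> spans C S"
    unfolding span_iso_def by blast
  show "sym (span_iso C S)"
    unfolding span_iso_def sym_def by blast
  have "isomorphism C (Idt C (Dom C (fst p)))" if "p \<in> spans C S" for p
    using inverse_of_Idt Dom_closed spansD[OF that] isomorphism_iff_inverse_of by blast
  then show "refl_on (spans C S) (span_iso C S)"
    unfolding refl_on_def span_iso_iff using span_mor_Idt by blast
  show "trans (span_iso C S)"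
  proof (rule transI)
    fix p q r assume pq: "(p, q) \<in> span_iso C S" and qr: "(q, r) \<in> span_iso C S"
    then obtain x y where x: "isomorphism C x" "span_mor C p q x"
        and y: "isomorphism C y" "span_mor C q r y"
      unfolding span_iso_iff by blast
    have r: "r \<in> spans C S"
      using qr span_iso_iff by blast
    have "span_mor C p r (y \<cdot>\<^bsub>C\<^esub> x)"
      using span_mor_Comp[OF category_axioms x(2) y(2)] spansD[OF r] by blast
    moreover have "isomorphism C (y \<cdot>\<^bsub>C\<^esub> x)"
      using x y by (intro isomorphism_Comp) (simp_all add: span_mor_def)
    ultimately show "(p, r) \<in> span_iso C S"
      using pq r unfolding span_iso_iff by blast
  qed
qed

lemma span_class_eqI: "(p, q) \<in> span_iso C S \<Longrightarrow> span_class C S p = span_class C S q"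
  by (rule equiv_class_eq[OF equiv_span_iso])

lemma span_class_self: "p \<in> spans C S \<Longrightarrow> p \<in> span_class C S p"
  by (rule equiv_class_self[OF equiv_span_iso])

lemma composite_in_spans:
  assumes "p \<in> spans C S" "q \<in> spans C S" "is_pullback C (snd p) (fst q) t' f'"
  shows "(fst p \<cdot>\<^bsub>C\<^esub> t', snd q \<cdot>\<^bsub>C\<^esub> f') \<in> spans C S"
proof -
  note D = is_pullbackD[OF assms(3)] spansD[OF assms(1)] spansD[OF assms(2)]
  have "t' \<in> S"
    using S_pullback assms(3) D by blast
  then show ?thesis
    using D by (simp add: S_Comp Comp_closed Dom_Comp)
qed

text \<open>The class \<open>W\<close> is \<open>S\<close> when composition is shown to respect \<open>\<sim>\<^sub>z\<close>, and the class of all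
  isomorphisms when it is shown to respect isomorphism of spans.\<close>

lemma composite_span_mor:
  assumes W: "span_base C W"
    and spans: "p \<in> spans C S" "p1 \<in> spans C S" "q \<in> spans C S" "q1 \<in> spans C S"
    and x: "x \<in> W" "span_mor C p p1 x" and y: "y \<in> W" "span_mor C q q1 y"
    and pb: "is_pullback C (snd p) (fst q) t' f'"
    and pb1: "is_pullback C (snd p1) (fst q1) t1' f1'"
  shows "\<exists>z\<in>W. span_mor C (fst p \<cdot>\<^bsub>C\<^esub> t', snd q \<cdot>\<^bsub>C\<^esub> f') (fst p1 \<cdot>\<^bsub>C\<^esub> t1', snd q1 \<cdot>\<^bsub>C\<^esub> f1') z"
proof -
  interpret W: span_base C W by (rule W)
  note D = is_pullbackD[OF pb] and D1 = is_pullbackD[OF pb1]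
  note P = spansD[OF spans(1)] and P1 = spansD[OF spans(2)]
    and Q = spansD[OF spans(3)] and Q1 = spansD[OF spans(4)]
  have x': "x \<in> Arr C" "Dom C x = Dom C (fst p)" "Cod C x = Dom C (fst p1)"
      "fst p1 \<cdot>\<^bsub>C\<^esub> x = fst p" "snd p1 \<cdot>\<^bsub>C\<^esub> x = snd p"
    and y': "y \<in> Arr C" "Dom C y = Dom C (fst q)" "Cod C y = Dom C (fst q1)"
      "fst q1 \<cdot>\<^bsub>C\<^esub> y = fst q" "snd q1 \<cdot>\<^bsub>C\<^esub> y = snd q"
    using x y by (simp_all add: span_mor_def)
  \<comment> \<open>The comparison passes through the mixed pullback of \<open>fst q1\<close> along
    \<open>snd p\<close>: \<open>b\<close> leads into it from the square of \<open>p\<close> and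
    \<open>q\<close>, changing \<open>q\<close> to \<open>q1\<close>; then \<open>a\<close> leads
    on, changing \<open>p\<close> to \<open>p1\<close>.\<close>
  have "Cod C (snd p) = Cod C (fst q1)"
    using D(5) span_mor_Cod[OF y(2) spans(4)] by simp
  then obtain u v where uv: "is_pullback C (snd p) (fst q1) u v"
    using S_pullback_ex Q1(1) P(3) by blast
  note E = is_pullbackD[OF uv]
  have "Cod C x = Dom C (snd p1)" "is_pullback C (snd p1 \<cdot>\<^bsub>C\<^esub> x) (fst q1) u v"
    using uv x' P1 by simp_all
  then obtain a where a: "a \<in> Arr C" "Dom C a = Dom C u" "Cod C a = Dom C t1'"
      "t1' \<cdot>\<^bsub>C\<^esub> a = x \<cdot>\<^bsub>C\<^esub> u" "f1' \<cdot>\<^bsub>C\<^esub> a = v" "is_pullback C t1' x a u"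
    by (rule is_pullback_cancel[OF pb1 x'(1)])
  \<comment> \<open>Because \<open>fst q\<close> is \<open>fst q1 \<cdot> y\<close>, the
    cancellation that gave \<open>a\<close> also gives \<open>b\<close> once both squares are
    transposed.\<close>
  have "is_pullback C (fst q1 \<cdot>\<^bsub>C\<^esub> y) (snd p) f' t'"
    using is_pullback_sym[OF pb] y' by simp
  then obtain b where b: "b \<in> Arr C" "Dom C b = Dom C f'" "Cod C b = Dom C v"
      "v \<cdot>\<^bsub>C\<^esub> b = y \<cdot>\<^bsub>C\<^esub> f'" "u \<cdot>\<^bsub>C\<^esub> b = t'" "is_pullback C v y b f'"
    by (rule is_pullback_cancel[OF is_pullback_sym[OF uv] y'(1,3)])
  have ab: "Dom C a = Cod C b"
    using a(2) b(3) E(6) by simp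
  \<comment> \<open>Here \<open>a\<close> is a pullback of \<open>x\<close> along
    \<open>t1'\<close>, and \<open>b\<close> is a pullback of \<open>y\<close> along
    \<open>v\<close>.\<close>
  have "a \<cdot>\<^bsub>C\<^esub> b \<in> W"
    using W.S_Comp W.S_pullback[OF x(1) a(6)] W.S_pullback[OF y(1) b(6)] ab by blast
  moreover have "(fst p1 \<cdot>\<^bsub>C\<^esub> t1') \<cdot>\<^bsub>C\<^esub> (a \<cdot>\<^bsub>C\<^esub> b) = fst p \<cdot>\<^bsub>C\<^esub> t'"
  proof -
    have "(fst p1 \<cdot>\<^bsub>C\<^esub> t1') \<cdot>\<^bsub>C\<^esub> (a \<cdot>\<^bsub>C\<^esub> b) = fst p1 \<cdot>\<^bsub>C\<^esub> ((t1' \<cdot>\<^bsub>C\<^esub> a) \<cdot>\<^bsub>C\<^esub> b)"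
      using P1 D1(3,7) a(1,3) b(1) ab by (simp add: cat_simps)
    also have "\<dots> = fst p1 \<cdot>\<^bsub>C\<^esub> (x \<cdot>\<^bsub>C\<^esub> t')"
      unfolding a(4) b(5)[symmetric] using x'(1,2) E(3,6,7) P(4) b(1,3) by (simp add: Comp_assoc)
    also have "\<dots> = fst p \<cdot>\<^bsub>C\<^esub> t'"
      unfolding x'(4)[symmetric] using P1(2) x'(1-3) D(3,7) P(4) by (simp add: Comp_assoc)
    finally show ?thesis .
  qed
  moreover have "(snd q1 \<cdot>\<^bsub>C\<^esub> f1') \<cdot>\<^bsub>C\<^esub> (a \<cdot>\<^bsub>C\<^esub> b) = snd q \<cdot>\<^bsub>C\<^esub> f'"
  proof -
    have "(snd q1 \<cdot>\<^bsub>C\<^esub> f1') \<cdot>\<^bsub>C\<^esub> (a \<cdot>\<^bsub>C\<^esub> b) = snd q1 \<cdot>\<^bsub>C\<^esub> ((f1' \<cdot>\<^bsub>C\<^esub> a) \<cdot>\<^bsub>C\<^esub> b)"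
      using Q1 D1(4,6,8) a(1,3) b(1) ab by (simp add: cat_simps)
    also have "\<dots> = snd q1 \<cdot>\<^bsub>C\<^esub> (y \<cdot>\<^bsub>C\<^esub> f')"
      unfolding a(5) b(4) ..
    also have "\<dots> = snd q \<cdot>\<^bsub>C\<^esub> f'"
      unfolding y'(5)[symmetric] using Q1(3,4) y'(1-3) D(4,8) by (simp add: Comp_assoc)
    finally show ?thesis .
  qed
  ultimately show ?thesis
    using a(1-3) b(1,2) ab P(2) P1(2) D(3,6,7) D1(3,7) P(4) P1(4)
    by (intro bexI[of _ "a \<cdot>\<^bsub>C\<^esub> b"]) (simp_all add: span_mor_def Comp_closed Dom_Comp Cod_Comp)
qed

section \<open>The operations of the category of spans in terms of representatives\<close>

lemma Span_simps [simp]: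
  "Obj (Span C S) = Obj C" "Arr (Span C S) = spans C S // span_iso C S"
  "Idt (Span C S) A = span_class C S (Idt C A, Idt C A)"
  by (simp_all add: Span_def)

text \<open>The representative picked by \<open>SOME\<close> is linked to \<open>p\<close> by a span
  morphism, and such morphisms preserve both end objects.\<close>

lemma Span_Dom_Cod:
  assumes "p \<in> spans C S"
  shows "Dom (Span C S) (span_class C S p) = Cod C (fst p)"
    and "Cod (Span C S) (span_class C S p) = Cod C (snd p)"
proof -
  define q where "q = (SOME q. q \<in> span_class C S p)"
  have "q \<in> span_class C S p"
    unfolding q_def using span_class_self[OF assms] by (rule someI)
  then obtain x where "span_mor C p q x" "q \<in> spans C S"
    unfolding Image_singleton_iff span_iso_iff by blast
  from span_mor_Cod[OF this] show "Dom (Span C S) (span_class C S p) = Cod C (fst p)"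
    and "Cod (Span C S) (span_class C S p) = Cod C (snd p)"
    unfolding Span_def q_def by simp_all
qed

text \<open>The union defining composition collapses: by \<open>composite_span_mor\<close> for the
  class of isomorphisms, all representatives and all pullback squares yield isomorphic
  composites.\<close>

lemma Span_Comp:
  assumes p: "p \<in> spans C S" and q: "q \<in> spans C S"
    and pb: "is_pullback C (snd p) (fst q) t' f'"
  shows "span_class C S q \<cdot>\<^bsub>Span C S\<^esub> span_class C S p =
    span_class C S (fst p \<cdot>\<^bsub>C\<^esub> t', snd q \<cdot>\<^bsub>C\<^esub> f')"
proof -
  let ?c = "span_class C S (fst p \<cdot>\<^bsub>C\<^esub> t', snd q \<cdot>\<^bsub>C\<^esub> f')"
  let ?A = "{span_class C S (s \<cdot>\<^bsub>C\<^esub> u, g \<cdot>\<^bsub>C\<^esub> v) | s f t g u v.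
    (s, f) \<in> span_class C S p \<and> (t, g) \<in> span_class C S q \<and> is_pullback C f t u v}"
  have "X = ?c" if "X \<in> ?A" for X
  proof -
    from that obtain s f t g u v where X: "X = span_class C S (s \<cdot>\<^bsub>C\<^esub> u, g \<cdot>\<^bsub>C\<^esub> v)"
      and sf: "(p, (s, f)) \<in> span_iso C S" and tg: "(q, (t, g)) \<in> span_iso C S"
      and uv: "is_pullback C f t u v"
      by auto
    from sf tg obtain x y where "(s, f) \<in> spans C S" "(t, g) \<in> spans C S"
        "isomorphism C x" "span_mor C p (s, f) x" "isomorphism C y" "span_mor C q (t, g) y"
      unfolding span_iso_iff by blast
    then have "((fst p \<cdot>\<^bsub>C\<^esub> t', snd q \<cdot>\<^bsub>C\<^esub> f'), (s \<cdot>\<^bsub>C\<^esub> u, g \<cdot>\<^bsub>C\<^esub> v)) \<in> span_iso C S"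
      using composite_span_mor[OF span_base_isomorphisms p _ q, of "(s, f)" "(t, g)" x y t' f' u v]
        composite_in_spans[OF p q pb] composite_in_spans[of "(s, f)" "(t, g)" u v] pb uv
      unfolding span_iso_iff fst_conv snd_conv mem_Collect_eq by blast
    then show "X = ?c"
      using X span_class_eqI by simp
  qed
  moreover have "?c \<in> ?A"
    unfolding mem_Collect_eq
    using span_class_self[OF p] span_class_self[OF q] pb
    by (intro exI[of _ "fst p"] exI[of _ "snd p"] exI[of _ "fst q"] exI[of _ "snd q"]
        exI[of _ t'] exI[of _ f']) (simp del: Image_singleton_iff)
  ultimately have "?A = {?c}"
    by blast
  then have "\<Union> ?A = ?c"
    by simp
  then show ?thesis
    by (simp add: Span_def)
qed

end

section \<open>The quotient category\<close>

context span_base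
begin

text \<open>Both end objects are put into one value so that they can serve as an invariant under
  \<open>\<sim>\<^sub>z\<close>.\<close>

lemma S_step_ends:
  assumes "span_mor C p q x" "q \<in> spans C S"
  shows "(Cod C (fst p), Cod C (snd p)) = (Cod C (fst q), Cod C (snd q))"
  using span_mor_Cod[OF assms] by simp

lemma z_step_subset_Arr: "z_step C S \<subseteq> Arr (Span C S) \<times> Arr (Span C S)"
  by (auto simp: z_step_def intro!: quotientI)

lemma equiv_z_rel: "equiv (Arr (Span C S)) (z_rel C S)"
proof (rule equivI)
  let ?A = "Arr (Span C S)"
  \<comment> \<open>The full relation is a member of the intersected family, which confines the
    intersection to pairs from \<open>?A\<close>.\<close>
  have "equiv ?A (?A \<times> ?A)"
    by (auto simp: equiv_def refl_on_def sym_def trans_def)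
  then show "z_rel C S \<subseteq> ?A \<times> ?A"
    using z_step_subset_Arr unfolding z_rel_def by blast
  show "refl_on ?A (z_rel C S)"
    unfolding z_rel_def equiv_def refl_on_def by blast
  show "sym (z_rel C S)"
    unfolding z_rel_def equiv_def sym_def by blast
  show "trans (z_rel C S)"
    unfolding z_rel_def equiv_def trans_def by blast
qed

text \<open>Arrows of \<open>Retr C S\<close> are classes of classes; this names each of them by a
  single span.\<close>

definition retr_class :: "'a \<times> 'a \<Rightarrow> ('a \<times> 'a) set set" where
  "retr_class p = z_rel C S `` {span_class C S p}"

lemma span_class_in_Arr: "p \<in> spans C S \<Longrightarrow> span_class C S p \<in> Arr (Span C S)"
  by (simp add: quotientI)

lemma retr_class_eq_iff:
  assumes "p \<in> spans C S" "q \<in> spans C S"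
  shows "retr_class p = retr_class q \<longleftrightarrow> (span_class C S p, span_class C S q) \<in> z_rel C S"
  unfolding retr_class_def
  by (rule eq_equiv_class_iff[OF equiv_z_rel]) (rule span_class_in_Arr, rule assms)+

lemma retr_class_step:
  assumes "p \<in> spans C S" "q \<in> spans C S" "x \<in> S" "span_mor C p q x"
  shows "retr_class p = retr_class q"
proof -
  have "(span_class C S p, span_class C S q) \<in> z_step C S"
    using assms unfolding z_step_def by blast
  then show ?thesis
    unfolding retr_class_eq_iff[OF assms(1,2)] z_rel_def by blast
qed

text \<open>Induction over \<open>\<sim>\<^sub>z\<close> in kernel form: kernels are equivalence relations for free.\<close>

lemma retr_class_invariant:
  assumes step: "\<And>p q x. p \<in> spans C S \<Longrightarrow> q \<in> spans C S \<Longrightarrow> x \<in> S \<Longrightarrow> span_mor C p q x \<Longrightarrow> \<phi> p = \<phi> q"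
    and eq: "retr_class p = retr_class q" and p: "p \<in> spans C S" and q: "q \<in> spans C S"
  shows "\<phi> p = \<phi> q"
proof -
  let ?A = "Arr (Span C S)"
  \<comment> \<open>Demanding agreement on all members makes \<open>R\<close> a relation between
    classes without a choice of representatives.\<close>
  define R where "R = {(X, Y). X \<in> ?A \<and> Y \<in> ?A \<and> (\<forall>p\<in>X. \<forall>q\<in>Y. \<phi> p = \<phi> q)}"
  \<comment> \<open>Isomorphisms belong to \<open>S\<close>, so \<open>\<phi>\<close> is constant on
    isomorphism classes.\<close>
  have iso: "\<phi> p = \<phi> q" if "(p, q) \<in> span_iso C S" for p q
    using that step S_iso unfolding span_iso_iff by blast
  have "equiv ?A R"
  proof (rule equivI)
    show "R \<subseteq> ?A \<times> ?A" "sym R"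
      by (auto simp: R_def sym_def)
    show "refl_on ?A R"
    proof (rule refl_onI)
      fix X assume "X \<in> ?A"
      moreover have "(p, q) \<in> span_iso C S" if "p \<in> X" "q \<in> X" for p q
        using quotient_eq_iff[OF equiv_span_iso, of X X p q] that \<open>X \<in> ?A\<close> by simp
      ultimately show "(X, X) \<in> R"
        unfolding R_def using iso by blast
    qed
    show "trans R"
    proof (rule transI)
      fix X Y Z assume XY: "(X, Y) \<in> R" and YZ: "(Y, Z) \<in> R"
      \<comment> \<open>The values on \<open>X\<close> and \<open>Z\<close> are linked through a
        member of the middle class, which is non-empty.\<close>
      then obtain q where "q \<in> Y"
        using in_quotient_imp_non_empty[OF equiv_span_iso, of Y] unfolding R_def by auto
      with XY YZ show "(X, Z) \<in> R"
        unfolding R_def by fastforce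
    qed
  qed
  moreover have "z_step C S \<subseteq> R"
  proof
    fix XY assume "XY \<in> z_step C S"
    then obtain p q x where XY: "XY = (span_class C S p, span_class C S q)"
        and pq: "p \<in> spans C S" "q \<in> spans C S" "x \<in> S" "span_mor C p q x"
      unfolding z_step_def by blast
    have "\<phi> p' = \<phi> q'" if "p' \<in> span_class C S p" "q' \<in> span_class C S q" for p' q'
      using iso[of p p'] iso[of q q'] that step[OF pq] by simp
    then show "XY \<in> R"
      unfolding XY R_def using pq(1,2) span_class_in_Arr by blast
  qed
  ultimately have "z_rel C S \<subseteq> R"
    unfolding z_rel_def by blast
  then have "(span_class C S p, span_class C S q) \<in> R"
    using eq retr_class_eq_iff[OF p q] by blast
  then show ?thesis
    using span_class_self[OF p] span_class_self[OF q] unfolding R_def by blast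
qed

lemma retr_class_ends:
  assumes "retr_class p = retr_class q" "p \<in> spans C S" "q \<in> spans C S"
  shows "Cod C (fst p) = Cod C (fst q)" "Cod C (snd p) = Cod C (snd q)"
  using retr_class_invariant[of "\<lambda>p. (Cod C (fst p), Cod C (snd p))", OF S_step_ends assms] by simp_all

text \<open>Replaces the representatives in the definitions of domain, codomain and composition of
  the quotient, which are classes themselves, by spans.\<close>

lemma retr_class_memE:
  assumes "X \<in> retr_class p" "p \<in> spans C S"
  obtains q where "q \<in> spans C S" "X = span_class C S q" "retr_class q = retr_class p"
proof -
  have pX: "(span_class C S p, X) \<in> z_rel C S"
    using assms(1) by (simp add: retr_class_def)
  then have "X \<in> spans C S // span_iso C S"
    using equiv_type[OF equiv_z_rel] by auto
  then obtain q where q: "q \<in> spans C S" "X = span_class C S q"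
    by (rule quotientE)
  then have "retr_class q = retr_class p"
    using pX retr_class_eq_iff[OF assms(2) q(1)] by simp
  with q show thesis
    using that by blast
qed

lemma span_class_in_retr_class: "p \<in> spans C S \<Longrightarrow> span_class C S p \<in> retr_class p"
  unfolding retr_class_def by (rule equiv_class_self[OF equiv_z_rel span_class_in_Arr])

lemma Retr_simps [simp]: "Obj (Retr C S) = Obj C"
    "Idt (Retr C S) A = retr_class (Idt C A, Idt C A)"
  by (simp_all add: Retr_def quotient_cat_def retr_class_def)

lemma Retr_Arr_iff: "X \<in> Arr (Retr C S) \<longleftrightarrow> (\<exists>p\<in>spans C S. X = retr_class p)"
  unfolding Retr_def quotient_cat_def retr_class_def by (auto simp: quotient_def)

lemma Retr_Dom_Cod:
  assumes "p \<in> spans C S"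
  shows "Dom (Retr C S) (retr_class p) = Cod C (fst p)"
    and "Cod (Retr C S) (retr_class p) = Cod C (snd p)"
proof -
  define X where "X = (SOME X. X \<in> retr_class p)"
  have "X \<in> retr_class p"
    unfolding X_def using span_class_in_retr_class[OF assms] by (rule someI)
  then obtain q where "q \<in> spans C S" "X = span_class C S q" "retr_class q = retr_class p"
    by (rule retr_class_memE[OF _ assms])
  then have "Dom (Span C S) X = Cod C (fst p)" "Cod (Span C S) X = Cod C (snd p)"
    using Span_Dom_Cod[of q] retr_class_ends[of q p] assms by simp_all
  then show "Dom (Retr C S) (retr_class p) = Cod C (fst p)"
    and "Cod (Retr C S) (retr_class p) = Cod C (snd p)"
    unfolding X_def by (simp_all add: Retr_def quotient_cat_def)
qed

text \<open>Collecting the composites over all squares avoids choosing a pullback and leaves a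
  value, the empty set, for spans that do not meet. This makes it usable as an invariant of
  arbitrary pairs.\<close>

definition composites :: "'a \<times> 'a \<Rightarrow> 'a \<times> 'a \<Rightarrow> ('a \<times> 'a) set set set" where
  "composites q p = {retr_class (fst p \<cdot>\<^bsub>C\<^esub> t', snd q \<cdot>\<^bsub>C\<^esub> f') | t' f'.
     is_pullback C (snd p) (fst q) t' f'}"

text \<open>By \<open>composite_span_mor\<close> for the class \<open>S\<close>, the comparison
  arrow between the composites is itself a generating step.\<close>

lemma retr_class_composite:
  assumes spans: "p \<in> spans C S" "p1 \<in> spans C S" "q \<in> spans C S" "q1 \<in> spans C S"
    and "x \<in> S" "span_mor C p p1 x" "y \<in> S" "span_mor C q q1 y"
    and pb: "is_pullback C (snd p) (fst q) t' f'" and pb1: "is_pullback C (snd p1) (fst q1) t1' f1'"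
  shows "retr_class (fst p \<cdot>\<^bsub>C\<^esub> t', snd q \<cdot>\<^bsub>C\<^esub> f') = retr_class (fst p1 \<cdot>\<^bsub>C\<^esub> t1', snd q1 \<cdot>\<^bsub>C\<^esub> f1')"
  using composite_span_mor[OF span_base_axioms assms]
    retr_class_step[OF composite_in_spans[OF spans(1,3) pb] composite_in_spans[OF spans(2,4) pb1]]
  by blast

lemma pullback_exists:
  assumes "p \<in> spans C S" "q \<in> spans C S" "Cod C (snd p) = Cod C (fst q)"
  obtains t' f' where "is_pullback C (snd p) (fst q) t' f'"
  using S_pullback_ex[OF spansD(1)[OF assms(2)] spansD(3)[OF assms(1)] assms(3)] by blast

text \<open>Steps preserve end objects, so a square for one pair entails a square for the other, and
  the resulting classes agree.\<close>

lemma composites_step: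
  assumes spans: "p \<in> spans C S" "p1 \<in> spans C S" "q \<in> spans C S" "q1 \<in> spans C S"
    and x: "x \<in> S" "span_mor C p p1 x" and y: "y \<in> S" "span_mor C q q1 y"
  shows "composites q p = composites q1 p1"
proof -
  note cod = span_mor_Cod[OF x(2) spans(2)] span_mor_Cod[OF y(2) spans(4)]
  note eq = retr_class_composite[OF spans x y]
  show ?thesis
  proof
    show "composites q p \<subseteq> composites q1 p1"
    proof
      fix X assume "X \<in> composites q p"
      then obtain t' f' where X: "X = retr_class (fst p \<cdot>\<^bsub>C\<^esub> t', snd q \<cdot>\<^bsub>C\<^esub> f')"
          and pb: "is_pullback C (snd p) (fst q) t' f'"
        unfolding composites_def by blast
      obtain t1' f1' where pb1: "is_pullback C (snd p1) (fst q1) t1' f1'"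
        using pullback_exists[OF spans(2,4)] is_pullbackD(5)[OF pb] cod by metis
      show "X \<in> composites q1 p1"
        unfolding X eq[OF pb pb1] composites_def using pb1 by blast
    qed
    show "composites q1 p1 \<subseteq> composites q p"
    proof
      fix X assume "X \<in> composites q1 p1"
      then obtain t1' f1' where X: "X = retr_class (fst p1 \<cdot>\<^bsub>C\<^esub> t1', snd q1 \<cdot>\<^bsub>C\<^esub> f1')"
          and pb1: "is_pullback C (snd p1) (fst q1) t1' f1'"
        unfolding composites_def by blast
      obtain t' f' where pb: "is_pullback C (snd p) (fst q) t' f'"
        using pullback_exists[OF spans(1,3)] is_pullbackD(5)[OF pb1] cod by metis
      show "X \<in> composites q p"
        unfolding X eq[OF pb pb1, symmetric] composites_def using pb by blast
    qed
  qed
qed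

text \<open>Identities lie in \<open>S\<close>; this lets one factor of a composite vary while the
  other stays fixed.\<close>

lemma S_step_refl:
  assumes "p \<in> spans C S"
  obtains x where "x \<in> S" "span_mor C p p x"
  using span_mor_Idt[OF assms] Idt_in_S Dom_closed spansD(2)[OF assms] by blast

text \<open>The factors are changed one after the other, because the invariance principle treats a
  single varying span.\<close>

lemma composites_cong:
  assumes p: "retr_class p = retr_class p1" "p \<in> spans C S" "p1 \<in> spans C S"
    and q: "retr_class q = retr_class q1" "q \<in> spans C S" "q1 \<in> spans C S"
  shows "composites q p = composites q1 p1"
proof -
  obtain y where y: "y \<in> S" "span_mor C q q y"
    using S_step_refl[OF q(2)] .
  obtain x where x: "x \<in> S" "span_mor C p1 p1 x"
    using S_step_refl[OF p(3)] .
  have "composites q p = composites q p1"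
    using composites_step[OF _ _ q(2,2) _ _ y] by (rule retr_class_invariant[OF _ p])
  also have "\<dots> = composites q1 p1"
    using composites_step[OF p(3,3) _ _ x]
    by (rule retr_class_invariant[where \<phi> = "\<lambda>q. composites q p1", OF _ q])
  finally show ?thesis .
qed

text \<open>Two pullback squares for the same pair are compared by taking reflexive steps on both
  factors.\<close>

lemma composites_eq:
  assumes "p \<in> spans C S" "q \<in> spans C S" and pb: "is_pullback C (snd p) (fst q) t' f'"
  shows "composites q p = {retr_class (fst p \<cdot>\<^bsub>C\<^esub> t', snd q \<cdot>\<^bsub>C\<^esub> f')}"
proof -
  obtain x y where "x \<in> S" "span_mor C p p x" "y \<in> S" "span_mor C q q y"
    using S_step_refl assms(1,2) by metis
  from retr_class_composite[OF assms(1,1,2,2) this _ pb] show ?thesis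
    unfolding composites_def using pb by blast
qed

lemma Retr_Comp:
  assumes p: "p \<in> spans C S" and q: "q \<in> spans C S"
    and pb: "is_pullback C (snd p) (fst q) t' f'"
  shows "retr_class q \<cdot>\<^bsub>Retr C S\<^esub> retr_class p = retr_class (fst p \<cdot>\<^bsub>C\<^esub> t', snd q \<cdot>\<^bsub>C\<^esub> f')"
proof -
  let ?c = "retr_class (fst p \<cdot>\<^bsub>C\<^esub> t', snd q \<cdot>\<^bsub>C\<^esub> f')"
  let ?A = "{z_rel C S `` {Y \<cdot>\<^bsub>Span C S\<^esub> X} | X Y. X \<in> retr_class p \<and> Y \<in> retr_class q}"
  have "z_rel C S `` {Y \<cdot>\<^bsub>Span C S\<^esub> X} = ?c" if X: "X \<in> retr_class p" and Y: "Y \<in> retr_class q" for X Y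
  proof -
    obtain p' where p': "p' \<in> spans C S" "X = span_class C S p'" "retr_class p' = retr_class p"
      using X by (rule retr_class_memE[OF _ p])
    obtain q' where q': "q' \<in> spans C S" "Y = span_class C S q'" "retr_class q' = retr_class q"
      using Y by (rule retr_class_memE[OF _ q])
    have "Cod C (snd p') = Cod C (fst q')"
      using retr_class_ends[OF p'(3,1) p] retr_class_ends[OF q'(3,1) q] is_pullbackD(5)[OF pb] by simp
    then obtain u v where uv: "is_pullback C (snd p') (fst q') u v"
      using pullback_exists[OF p'(1) q'(1)] by blast
    \<comment> \<open>Passing to singletons makes \<open>composites_cong\<close> applicable, which
      removes the dependence on \<open>p'\<close> and \<open>q'\<close>.\<close>
    have "{z_rel C S `` {Y \<cdot>\<^bsub>Span C S\<^esub> X}} = composites q' p'"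
      unfolding p'(2) q'(2) Span_Comp[OF p'(1) q'(1) uv] composites_eq[OF p'(1) q'(1) uv]
      by (simp add: retr_class_def)
    also have "\<dots> = {?c}"
      using composites_cong[OF p'(3,1) p q'(3,1) q] composites_eq[OF p q pb] by simp
    finally show ?thesis
      by simp
  qed
  then have "?A = {?c}"
    using span_class_in_retr_class[OF p] span_class_in_retr_class[OF q] by blast
  then have "\<Union> ?A = ?c"
    by simp
  then show ?thesis
    by (simp add: Retr_def quotient_cat_def)
qed

lemma Retr_Comp':
  assumes "s \<in> S" "f \<in> Arr C" "Dom C s = Dom C f" "t \<in> S" "g \<in> Arr C" "Dom C t = Dom C g"
    and "is_pullback C f t t' f'"
  shows "retr_class (t, g) \<cdot>\<^bsub>Retr C S\<^esub> retr_class (s, f) = retr_class (s \<cdot>\<^bsub>C\<^esub> t', g \<cdot>\<^bsub>C\<^esub> f')"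
  using Retr_Comp[of "(s, f)" "(t, g)" t' f'] assms by simp

section \<open>The category laws of the quotient\<close>

lemma Retr_ArrE:
  assumes "X \<in> Arr (Retr C S)"
  obtains s f where "s \<in> S" "s \<in> Arr C" "f \<in> Arr C" "Dom C s = Dom C f" "X = retr_class (s, f)"
    "Dom (Retr C S) X = Cod C s" "Cod (Retr C S) X = Cod C f"
  using assms S_in_Arr Retr_Dom_Cod unfolding Retr_Arr_iff by fastforce

lemma retr_class_in_Arr: "s \<in> S \<Longrightarrow> f \<in> Arr C \<Longrightarrow> Dom C s = Dom C f \<Longrightarrow> retr_class (s, f) \<in> Arr (Retr C S)"
  unfolding Retr_Arr_iff by auto

lemma Retr_Dom_Cod':
  assumes "s \<in> S" "f \<in> Arr C" "Dom C s = Dom C f"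
  shows "Dom (Retr C S) (retr_class (s, f)) = Cod C s" "Cod (Retr C S) (retr_class (s, f)) = Cod C f"
  using Retr_Dom_Cod[of "(s, f)"] assms by simp_all

text \<open>Bundles representatives, one pullback square and the typing facts of the composite, as
  needed for both the category laws and functoriality of the extension.\<close>

lemma Retr_CompE:
  assumes "X \<in> Arr (Retr C S)" "Y \<in> Arr (Retr C S)" "Dom (Retr C S) Y = Cod (Retr C S) X"
  obtains s f t g t' f' where "s \<in> S" "f \<in> Arr C" "Dom C s = Dom C f" "X = retr_class (s, f)"
    "t \<in> S" "g \<in> Arr C" "Dom C t = Dom C g" "Y = retr_class (t, g)"
    "is_pullback C f t t' f'" "t' \<in> S"
    "s \<cdot>\<^bsub>C\<^esub> t' \<in> S" "g \<cdot>\<^bsub>C\<^esub> f' \<in> Arr C" "Dom C (s \<cdot>\<^bsub>C\<^esub> t') = Dom C (g \<cdot>\<^bsub>C\<^esub> f')"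
    "Cod C (s \<cdot>\<^bsub>C\<^esub> t') = Cod C s" "Cod C (g \<cdot>\<^bsub>C\<^esub> f') = Cod C g"
    "Y \<cdot>\<^bsub>Retr C S\<^esub> X = retr_class (s \<cdot>\<^bsub>C\<^esub> t', g \<cdot>\<^bsub>C\<^esub> f')"
proof -
  obtain s f where X: "s \<in> S" "s \<in> Arr C" "f \<in> Arr C" "Dom C s = Dom C f" "X = retr_class (s, f)"
      "Cod (Retr C S) X = Cod C f"
    using Retr_ArrE[OF assms(1)] by metis
  obtain t g where Y: "t \<in> S" "t \<in> Arr C" "g \<in> Arr C" "Dom C t = Dom C g" "Y = retr_class (t, g)"
      "Dom (Retr C S) Y = Cod C t"
    using Retr_ArrE[OF assms(2)] by metis
  have "Cod C f = Cod C t"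
    using X(6) Y(6) assms(3) by simp
  then obtain t' f' where pb: "is_pullback C f t t' f'"
    using S_pullback_ex[OF Y(1) X(3)] by blast
  note D = is_pullbackD[OF pb]
  have t': "t' \<in> S"
    by (rule S_pullback[OF Y(1) pb])
  have comp: "Y \<cdot>\<^bsub>Retr C S\<^esub> X = retr_class (s \<cdot>\<^bsub>C\<^esub> t', g \<cdot>\<^bsub>C\<^esub> f')"
    unfolding X(5) Y(5) by (rule Retr_Comp'[OF X(1,3,4) Y(1,3,4) pb])
  have st': "s \<cdot>\<^bsub>C\<^esub> t' \<in> S"
    using S_Comp[OF t' X(1)] D X by simp
  show thesis
    by (rule that[OF X(1,3,4,5) Y(1,3,4,5) pb t' st' _ _ _ _ comp])
      (use D X Y in \<open>simp_all add: Comp_closed Dom_Comp Cod_Comp\<close>)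
qed

text \<open>The unit laws use squares with an identity leg. For associativity, one further square is
  pasted onto each of the two squares of the inner composites, so that both bracketings have the
  same legs.\<close>

lemma category_Retr: "category (Retr C S)"
proof
  fix X assume "X \<in> Arr (Retr C S)"
  then obtain s f where X: "s \<in> S" "s \<in> Arr C" "f \<in> Arr C" "Dom C s = Dom C f" "X = retr_class (s, f)"
      "Dom (Retr C S) X = Cod C s" "Cod (Retr C S) X = Cod C f"
    by (rule Retr_ArrE)
  show "Dom (Retr C S) X \<in> Obj (Retr C S)" "Cod (Retr C S) X \<in> Obj (Retr C S)"
    unfolding X(6,7) using X by (simp_all add: Cod_closed)
  have A: "Idt C (Cod C s) \<in> S" "Idt C (Cod C f) \<in> S"
    using X Idt_in_S Cod_closed by blast+
  have "retr_class (s, f) \<cdot>\<^bsub>Retr C S\<^esub> retr_class (Idt C (Cod C s), Idt C (Cod C s)) =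
      retr_class (Idt C (Cod C s) \<cdot>\<^bsub>C\<^esub> s, f \<cdot>\<^bsub>C\<^esub> Idt C (Dom C s))"
    using X A S_in_Arr by (intro Retr_Comp' is_pullback_sym[OF is_pullback_Idt]) simp_all
  then show "X \<cdot>\<^bsub>Retr C S\<^esub> Idt (Retr C S) (Dom (Retr C S) X) = X"
    unfolding X(6) using X(2-5) by (simp add: Idt_Comp Comp_Idt)
  have "retr_class (Idt C (Cod C f), Idt C (Cod C f)) \<cdot>\<^bsub>Retr C S\<^esub> retr_class (s, f) =
      retr_class (s \<cdot>\<^bsub>C\<^esub> Idt C (Dom C f), Idt C (Cod C f) \<cdot>\<^bsub>C\<^esub> f)"
    using X A S_in_Arr by (intro Retr_Comp' is_pullback_Idt) simp_all
  then show "Idt (Retr C S) (Cod (Retr C S) X) \<cdot>\<^bsub>Retr C S\<^esub> X = X"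
    unfolding X(7) using X(2-5) by (simp add: Idt_Comp Comp_Idt')
next
  fix A assume "A \<in> Obj (Retr C S)"
  then have A: "A \<in> Obj C" "Idt C A \<in> S"
    using Idt_in_S by simp_all
  then show "Idt (Retr C S) A \<in> Arr (Retr C S)" "Dom (Retr C S) (Idt (Retr C S) A) = A"
    "Cod (Retr C S) (Idt (Retr C S) A) = A"
    by (simp_all add: retr_class_in_Arr Retr_Dom_Cod' S_in_Arr Cod_Idt)
next
  fix X Y assume XY: "X \<in> Arr (Retr C S)" "Y \<in> Arr (Retr C S)" "Dom (Retr C S) Y = Cod (Retr C S) X"
  obtain s f t g t' f' where "s \<in> S" "f \<in> Arr C" "Dom C s = Dom C f" "X = retr_class (s, f)"
      "t \<in> S" "g \<in> Arr C" "Dom C t = Dom C g" "Y = retr_class (t, g)"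
      "is_pullback C f t t' f'" "t' \<in> S"
      "s \<cdot>\<^bsub>C\<^esub> t' \<in> S" "g \<cdot>\<^bsub>C\<^esub> f' \<in> Arr C" "Dom C (s \<cdot>\<^bsub>C\<^esub> t') = Dom C (g \<cdot>\<^bsub>C\<^esub> f')"
      "Cod C (s \<cdot>\<^bsub>C\<^esub> t') = Cod C s" "Cod C (g \<cdot>\<^bsub>C\<^esub> f') = Cod C g"
      "Y \<cdot>\<^bsub>Retr C S\<^esub> X = retr_class (s \<cdot>\<^bsub>C\<^esub> t', g \<cdot>\<^bsub>C\<^esub> f')"
    by (rule Retr_CompE[OF XY])
  then show "Y \<cdot>\<^bsub>Retr C S\<^esub> X \<in> Arr (Retr C S)"
    "Dom (Retr C S) (Y \<cdot>\<^bsub>Retr C S\<^esub> X) = Dom (Retr C S) X"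
    "Cod (Retr C S) (Y \<cdot>\<^bsub>Retr C S\<^esub> X) = Cod (Retr C S) Y"
    by (simp_all add: retr_class_in_Arr Retr_Dom_Cod')
next
  fix X Y Z assume "X \<in> Arr (Retr C S)" "Y \<in> Arr (Retr C S)" "Z \<in> Arr (Retr C S)"
    and cod: "Dom (Retr C S) Y = Cod (Retr C S) X" "Dom (Retr C S) Z = Cod (Retr C S) Y"
  obtain s f where X: "s \<in> S" "s \<in> Arr C" "f \<in> Arr C" "Dom C s = Dom C f" "X = retr_class (s, f)"
      "Dom (Retr C S) X = Cod C s" "Cod (Retr C S) X = Cod C f"
    using \<open>X \<in> _\<close> by (rule Retr_ArrE)
  obtain t g where Y: "t \<in> S" "t \<in> Arr C" "g \<in> Arr C" "Dom C t = Dom C g" "Y = retr_class (t, g)"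
      "Dom (Retr C S) Y = Cod C t" "Cod (Retr C S) Y = Cod C g"
    using \<open>Y \<in> _\<close> by (rule Retr_ArrE)
  obtain r h where Z: "r \<in> S" "r \<in> Arr C" "h \<in> Arr C" "Dom C r = Dom C h" "Z = retr_class (r, h)"
      "Dom (Retr C S) Z = Cod C r" "Cod (Retr C S) Z = Cod C h"
    using \<open>Z \<in> _\<close> by (rule Retr_ArrE)
  obtain t' f' where P: "is_pullback C f t t' f'"
    using S_pullback_ex[OF Y(1) X(3)] cod X(7) Y(6) by auto
  obtain r' g' where Q: "is_pullback C g r r' g'"
    using S_pullback_ex[OF Z(1) Y(3)] cod Y(7) Z(6) by auto
  note DP = is_pullbackD[OF P] and DQ = is_pullbackD[OF Q]
  have S': "t' \<in> S" "r' \<in> S"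
    using S_pullback[OF Y(1) P] S_pullback[OF Z(1) Q] .
  \<comment> \<open>The further square lies over \<open>f'\<close> and \<open>r'\<close>, which end
    at the common source of \<open>t\<close> and \<open>g\<close>.\<close>
  have "Cod C f' = Cod C r'"
    using DP(8) DQ(7) Y(4) by simp
  then obtain r'' f'' where T: "is_pullback C f' r' r'' f''"
    using S_pullback_ex[OF S'(2) DP(4)] by blast
  note DT = is_pullbackD[OF T]
  have L: "is_pullback C f (t \<cdot>\<^bsub>C\<^esub> r') (t' \<cdot>\<^bsub>C\<^esub> r'') f''"
    by (rule is_pullback_paste[OF P T])
  \<comment> \<open>Here the pasting goes in the other direction, so both squares are transposed and
    the result is transposed back.\<close>
  have R: "is_pullback C (g \<cdot>\<^bsub>C\<^esub> f') r r'' (g' \<cdot>\<^bsub>C\<^esub> f'')"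
    by (rule is_pullback_sym[OF is_pullback_paste[OF is_pullback_sym[OF Q] is_pullback_sym[OF T]]])
  have tr: "t \<cdot>\<^bsub>C\<^esub> r' \<in> S" and st: "s \<cdot>\<^bsub>C\<^esub> t' \<in> S"
    using S_Comp[OF S'(2) Y(1)] S_Comp[OF S'(1) X(1)] DQ(7) DP(7) X(4) Y(4) by simp_all
  have "Z \<cdot>\<^bsub>Retr C S\<^esub> Y = retr_class (t \<cdot>\<^bsub>C\<^esub> r', h \<cdot>\<^bsub>C\<^esub> g')"
    unfolding Y(5) Z(5) by (rule Retr_Comp'[OF Y(1,3,4) Z(1,3,4) Q])
  moreover have "retr_class (t \<cdot>\<^bsub>C\<^esub> r', h \<cdot>\<^bsub>C\<^esub> g') \<cdot>\<^bsub>Retr C S\<^esub> X =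
      retr_class (s \<cdot>\<^bsub>C\<^esub> (t' \<cdot>\<^bsub>C\<^esub> r''), (h \<cdot>\<^bsub>C\<^esub> g') \<cdot>\<^bsub>C\<^esub> f'')"
    unfolding X(5) by (rule Retr_Comp'[OF X(1,3,4) tr _ _ L])
      (use Y(2,4) Z(2-4) DQ(3,4,6-8) in \<open>simp_all add: Comp_closed Dom_Comp\<close>)
  moreover have "Y \<cdot>\<^bsub>Retr C S\<^esub> X = retr_class (s \<cdot>\<^bsub>C\<^esub> t', g \<cdot>\<^bsub>C\<^esub> f')"
    unfolding X(5) Y(5) by (rule Retr_Comp'[OF X(1,3,4) Y(1,3,4) P])
  moreover have "Z \<cdot>\<^bsub>Retr C S\<^esub> retr_class (s \<cdot>\<^bsub>C\<^esub> t', g \<cdot>\<^bsub>C\<^esub> f') =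
      retr_class ((s \<cdot>\<^bsub>C\<^esub> t') \<cdot>\<^bsub>C\<^esub> r'', h \<cdot>\<^bsub>C\<^esub> (g' \<cdot>\<^bsub>C\<^esub> f''))"
    unfolding Z(5) by (rule Retr_Comp'[OF st _ _ Z(1,3,4) R])
      (use X(2,4) Y(3,4) DP(3,4,6-8) in \<open>simp_all add: Comp_closed Dom_Comp\<close>)
  moreover have "s \<cdot>\<^bsub>C\<^esub> (t' \<cdot>\<^bsub>C\<^esub> r'') = (s \<cdot>\<^bsub>C\<^esub> t') \<cdot>\<^bsub>C\<^esub> r''"
    by (rule Comp_assoc[symmetric]) (use X(2,4) DP(3,6,7) DT(3,7) in simp_all)
  moreover have "(h \<cdot>\<^bsub>C\<^esub> g') \<cdot>\<^bsub>C\<^esub> f'' = h \<cdot>\<^bsub>C\<^esub> (g' \<cdot>\<^bsub>C\<^esub> f'')"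
    by (rule Comp_assoc) (use Z(3,4) DQ(4,6,8) DT(4,8) in simp_all)
  ultimately show "(Z \<cdot>\<^bsub>Retr C S\<^esub> Y) \<cdot>\<^bsub>Retr C S\<^esub> X = Z \<cdot>\<^bsub>Retr C S\<^esub> (Y \<cdot>\<^bsub>Retr C S\<^esub> X)"
    by simp
qed

end

section \<open>The universal property\<close>

lemma is_functorD:
  assumes "is_functor C D F"
  shows "category C" "category D"
    and "\<And>A. A \<in> Obj C \<Longrightarrow> omap F A \<in> Obj D"
    and "\<And>A. A \<in> Obj C \<Longrightarrow> amap F (Idt C A) = Idt D (omap F A)"
    and "\<And>f. f \<in> Arr C \<Longrightarrow> amap F f \<in> Arr D"
    and "\<And>f. f \<in> Arr C \<Longrightarrow> Dom D (amap F f) = omap F (Dom C f)"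
    and "\<And>f. f \<in> Arr C \<Longrightarrow> Cod D (amap F f) = omap F (Cod C f)"
    and "\<And>f g. f \<in> Arr C \<Longrightarrow> g \<in> Arr C \<Longrightarrow> Dom C g = Cod C f \<Longrightarrow>
      amap F (g \<cdot>\<^bsub>C\<^esub> f) = amap F g \<cdot>\<^bsub>D\<^esub> amap F f"
  using assms unfolding is_functor_def by blast+

lemma is_functor_comp:
  assumes F: "is_functor C D F" and G: "is_functor D E G"
  shows "is_functor C E (comp_functor G F)"
  unfolding is_functor_def comp_functor_def
  using is_functorD[OF F] is_functorD[OF G] by simp

lemma is_functor_id:
  assumes "category C"
  shows "is_functor C C id_functor"
  using assms unfolding is_functor_def id_functor_def by simp

lemma functor_inverse_of:
  assumes F: "is_functor C D F" and fg: "category.inverse_of C f g"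
  shows "category.inverse_of D (amap F f) (amap F g)"
proof -
  note FD = is_functorD[OF F]
  interpret C: category C by (rule FD(1))
  interpret D: category D by (rule FD(2))
  have "amap F (g \<cdot>\<^bsub>C\<^esub> f) = Idt D (omap F (Dom C f))" "amap F (f \<cdot>\<^bsub>C\<^esub> g) = Idt D (omap F (Cod C f))"
    using fg FD(4) C.Dom_closed C.Cod_closed unfolding C.inverse_of_def by auto
  moreover have "amap F (g \<cdot>\<^bsub>C\<^esub> f) = amap F g \<cdot>\<^bsub>D\<^esub> amap F f" "amap F (f \<cdot>\<^bsub>C\<^esub> g) = amap F f \<cdot>\<^bsub>D\<^esub> amap F g"
    by (rule FD(8); use fg in \<open>simp add: C.inverse_of_def\<close>)+
  ultimately show ?thesis
    using fg FD(5-7) unfolding C.inverse_of_def D.inverse_of_def by simp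
qed

text \<open>The usual argument for universal objects. Each universal property is tested at the types
  of both categories: at those of the other one to obtain \<open>I\<close> and \<open>J\<close>, at
  its own to compare their composites with identities.\<close>

lemma category_of_fractions_unique:
  fixes R :: "('p, 'b) cat" and K :: "('q, 'c) cat"
  assumes K: "category_of_fractions C S K L TYPE('q \<times> 'c) \<and>
      category_of_fractions C S K L TYPE('p \<times> 'b)"
    and RK: "category_of_fractions C S R M TYPE('q \<times> 'c)"
    and RR: "category_of_fractions C S R M TYPE('p \<times> 'b)"
  shows "\<exists>I. category_iso R K I \<and> functor_eq C (comp_functor I M) L"
proof -
  have L: "is_functor C K L" "inverts S K L" and M: "is_functor C R M" "inverts S R M"
    using K RR unfolding category_of_fractions_def by blast+
  obtain I where I: "is_functor R K I" "functor_eq C (comp_functor I M) L"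
    using RK L unfolding category_of_fractions_def by blast
  obtain J where J: "is_functor K R J" "functor_eq C (comp_functor J L) M"
    using K M unfolding category_of_fractions_def by blast
  have "functor_eq C (comp_functor (comp_functor J I) M) M"
    using I(2) J(2) unfolding functor_eq_def comp_functor_def by simp
  moreover have "functor_eq C (comp_functor id_functor M) M"
    unfolding functor_eq_def comp_functor_def id_functor_def by simp
  moreover have "is_functor R R (comp_functor J I)" "is_functor R R id_functor"
    using is_functor_comp[OF I(1) J(1)] is_functor_id is_functorD(1)[OF I(1)] by blast+
  \<comment> \<open>Both the composite and the identity extend \<open>M\<close> along
    \<open>M\<close>, so both agree with this \<open>G\<close>.\<close>
  moreover obtain G where "\<forall>G'. is_functor R R G' \<and> functor_eq C (comp_functor G' M) M \<longrightarrow>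
      functor_eq R G' G"
    using RR M unfolding category_of_fractions_def by blast
  ultimately have JI: "functor_eq R (comp_functor J I) G" "functor_eq R id_functor G"
    by blast+
  have "functor_eq C (comp_functor (comp_functor I J) L) L"
    using I(2) J(2) unfolding functor_eq_def comp_functor_def by simp
  moreover have "functor_eq C (comp_functor id_functor L) L"
    unfolding functor_eq_def comp_functor_def id_functor_def by simp
  moreover have "is_functor K K (comp_functor I J)" "is_functor K K id_functor"
    using is_functor_comp[OF J(1) I(1)] is_functor_id is_functorD(1)[OF J(1)] by blast+
  moreover obtain H where "\<forall>G'. is_functor K K G' \<and> functor_eq C (comp_functor G' L) L \<longrightarrow>
      functor_eq K G' H"
    using K L unfolding category_of_fractions_def by blast
  ultimately have "functor_eq K (comp_functor I J) H" "functor_eq K id_functor H"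
    by blast+
  with JI have "functor_eq R (comp_functor J I) id_functor" "functor_eq K (comp_functor I J) id_functor"
    unfolding functor_eq_def by simp_all
  then show ?thesis
    using I J(1) unfolding category_iso_def by blast
qed

section \<open>The localizing functor and the inverses in the quotient\<close>

context span_base
begin

lemma retr_functor_simps [simp]: "omap (retr_functor C S) A = A"
    "amap (retr_functor C S) f = retr_class (Idt C (Dom C f), f)"
  by (simp_all add: retr_functor_def retr_class_def)

lemma Idt_Dom_in_S: "f \<in> Arr C \<Longrightarrow> Idt C (Dom C f) \<in> S"
  using Idt_in_S Dom_closed by blast

lemma is_functor_retr_functor: "is_functor C (Retr C S) (retr_functor C S)"
  unfolding is_functor_def
proof (intro conjI ballI impI)
  fix f assume f: "f \<in> Arr C"
  show "amap (retr_functor C S) f \<in> Arr (Retr C S)"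
    "Dom (Retr C S) (amap (retr_functor C S) f) = omap (retr_functor C S) (Dom C f)"
    "Cod (Retr C S) (amap (retr_functor C S) f) = omap (retr_functor C S) (Cod C f)"
    using f Idt_Dom_in_S[OF f] by (simp_all add: retr_class_in_Arr Retr_Dom_Cod' cat_simps)
  fix g assume g: "g \<in> Arr C" and fg: "Dom C g = Cod C f"
  have "retr_class (Idt C (Dom C g), g) \<cdot>\<^bsub>Retr C S\<^esub> retr_class (Idt C (Dom C f), f) =
      retr_class (Idt C (Dom C f) \<cdot>\<^bsub>C\<^esub> Idt C (Dom C f), g \<cdot>\<^bsub>C\<^esub> f)"
    using f g Idt_Dom_in_S[OF f] Idt_Dom_in_S[OF g] is_pullback_Idt[OF f] fg
    by (intro Retr_Comp') (simp_all add: cat_simps)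
  then show "amap (retr_functor C S) (g \<cdot>\<^bsub>C\<^esub> f) =
      amap (retr_functor C S) g \<cdot>\<^bsub>Retr C S\<^esub> amap (retr_functor C S) f"
    using f g fg by (simp add: cat_simps Idt_Comp')
qed (simp_all add: category_axioms category_Retr Dom_Idt)

text \<open>The square for this composite consists of identities. As a consequence, a functor on the
  quotient is determined on arrows by its values on the classes of \<open>(1, f)\<close> and
  \<open>(s, 1)\<close>.\<close>

lemma retr_class_decomp:
  assumes "s \<in> S" "f \<in> Arr C" "Dom C s = Dom C f"
  shows "retr_class (s, f) =
    retr_class (Idt C (Dom C f), f) \<cdot>\<^bsub>Retr C S\<^esub> retr_class (s, Idt C (Dom C s))"
proof -
  have s: "s \<in> Arr C" and A: "Dom C f \<in> Obj C" "Idt C (Dom C f) \<in> S"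
    using assms S_in_Arr Dom_closed Idt_in_S by auto
  have "is_pullback C (Idt C (Dom C f)) (Idt C (Dom C f)) (Idt C (Dom C f)) (Idt C (Dom C f))"
    using is_pullback_Idt[of "Idt C (Dom C f)"] A by (simp add: cat_simps)
  then have "retr_class (Idt C (Dom C f), f) \<cdot>\<^bsub>Retr C S\<^esub> retr_class (s, Idt C (Dom C s)) =
      retr_class (s \<cdot>\<^bsub>C\<^esub> Idt C (Dom C f), f \<cdot>\<^bsub>C\<^esub> Idt C (Dom C f))"
    using assms A by (intro Retr_Comp') (simp_all add: cat_simps)
  then show ?thesis
    using assms(2,3) s by (simp add: Comp_Idt')
qed

lemma inverse_of_retr_functor:
  assumes s: "s \<in> S" and mono: "monomorphism C s"
  shows "category.inverse_of (Retr C S) (amap (retr_functor C S) s) (retr_class (s, Idt C (Dom C s)))"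
proof -
  interpret R: category "Retr C S" by (rule category_Retr)
  note s' = S_in_Arr[OF s]
  have A: "Dom C s \<in> Obj C" "Idt C (Dom C s) \<in> S" and B: "Cod C s \<in> Obj C" "Idt C (Cod C s) \<in> S"
    using s' Dom_closed Cod_closed Idt_in_S by auto
  \<comment> \<open>The square used is the trivial kernel pair of \<open>s\<close>.\<close>
  have "retr_class (s, Idt C (Dom C s)) \<cdot>\<^bsub>Retr C S\<^esub> retr_class (Idt C (Dom C s), s) =
      retr_class (Idt C (Dom C s) \<cdot>\<^bsub>C\<^esub> Idt C (Dom C s), Idt C (Dom C s) \<cdot>\<^bsub>C\<^esub> Idt C (Dom C s))"
    using s s' A monomorphism_is_pullback[OF mono] by (intro Retr_Comp') (simp_all add: cat_simps)
  \<comment> \<open>The step is \<open>s\<close> itself, as a morphism to the identity span. By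
    \<open>retr_class_decomp\<close> with both legs \<open>s\<close>, the left-hand side is the
    remaining composite.\<close>
  moreover have "retr_class (s, s) = retr_class (Idt C (Cod C s), Idt C (Cod C s))"
    using s s' B by (intro retr_class_step[of _ _ s]) (simp_all add: span_mor_def cat_simps Idt_Comp)
  ultimately show ?thesis
    using s s' A B retr_class_decomp[OF s s']
    by (simp add: R.inverse_of_def retr_class_in_Arr Retr_Dom_Cod' cat_simps Idt_Comp')
qed

lemma inverts_retr_functor:
  assumes "\<forall>s\<in>S. monomorphism C s"
  shows "inverts S (Retr C S) (retr_functor C S)"
  unfolding inverts_def
  using assms inverse_of_retr_functor category.isomorphism_iff_inverse_of[OF category_Retr] by blast

end

section \<open>Extension of an inverting functor to the quotient\<close>

locale inverting_functor = span_base C S for C :: "('o, 'a) cat" and S +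
  fixes D :: "('q, 'c) cat" and F :: "('o, 'a, 'q, 'c) func"
  assumes is_functor: "is_functor C D F" and inverting: "inverts S D F"
begin

sublocale D: category D
  by (rule is_functorD(2)[OF is_functor])

lemmas F_simps = is_functorD(3-8)[OF is_functor]

text \<open>Two-sided inverses are unique, so the choice is immaterial; it merely turns inversion
  into a function of \<open>s\<close>.\<close>

definition inv_F :: "'a \<Rightarrow> 'c" where
  "inv_F s = (SOME b. D.inverse_of (amap F s) b)"

lemma inv_F: "s \<in> S \<Longrightarrow> D.inverse_of (amap F s) (inv_F s)"
  using inverting unfolding inv_F_def inverts_def D.isomorphism_iff_inverse_of by (blast intro: someI)

lemma inv_F_closed:
  assumes "s \<in> S"
  shows "inv_F s \<in> Arr D" "Dom D (inv_F s) = omap F (Cod C s)" "Cod D (inv_F s) = omap F (Dom C s)"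
  using inv_F[OF assms] F_simps S_in_Arr[OF assms] unfolding D.inverse_of_def by simp_all

text \<open>Both sides are inverse to the image of \<open>t \<cdot> s\<close>.\<close>

lemma inv_F_Comp:
  assumes "s \<in> S" "t \<in> S" "Dom C t = Cod C s"
  shows "inv_F (t \<cdot>\<^bsub>C\<^esub> s) = inv_F s \<cdot>\<^bsub>D\<^esub> inv_F t"
proof (rule D.inverse_of_unique)
  show "D.inverse_of (amap F (t \<cdot>\<^bsub>C\<^esub> s)) (inv_F (t \<cdot>\<^bsub>C\<^esub> s))"
    using assms by (intro inv_F S_Comp)
  show "D.inverse_of (amap F (t \<cdot>\<^bsub>C\<^esub> s)) (inv_F s \<cdot>\<^bsub>D\<^esub> inv_F t)"
    using D.inverse_of_Comp[OF inv_F[OF assms(1)] inv_F[OF assms(2)]] assms S_in_Arr F_simps by simp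
qed

text \<open>The fraction is defined on spans first, so that the invariance principle can carry it
  over to classes.\<close>

definition span_val :: "'a \<times> 'a \<Rightarrow> 'c" where
  "span_val p = amap F (snd p) \<cdot>\<^bsub>D\<^esub> inv_F (fst p)"

lemma span_val_step:
  assumes p: "p \<in> spans C S" and q: "q \<in> spans C S" and x: "x \<in> S" "span_mor C p q x"
  shows "span_val p = span_val q"
proof -
  note P = spansD[OF p] and Q = spansD[OF q]
  have x': "x \<in> Arr C" "Cod C x = Dom C (fst q)" "fst p = fst q \<cdot>\<^bsub>C\<^esub> x" "snd p = snd q \<cdot>\<^bsub>C\<^esub> x"
    using x by (simp_all add: span_mor_def)
  note I = inv_F_closed[OF x(1)] inv_F_closed[OF Q(1)]
  have "span_val p = (amap F (snd q) \<cdot>\<^bsub>D\<^esub> amap F x) \<cdot>\<^bsub>D\<^esub> (inv_F x \<cdot>\<^bsub>D\<^esub> inv_F (fst q))"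
    unfolding span_val_def x'(3,4) using x(1) x'(1,2) Q by (simp add: F_simps inv_F_Comp)
  also have "\<dots> = amap F (snd q) \<cdot>\<^bsub>D\<^esub> (amap F x \<cdot>\<^bsub>D\<^esub> (inv_F x \<cdot>\<^bsub>D\<^esub> inv_F (fst q)))"
    using I x'(1,2) Q by (intro D.Comp_assoc) (simp_all add: F_simps D.Comp_closed D.Cod_Comp)
  also have "amap F x \<cdot>\<^bsub>D\<^esub> (inv_F x \<cdot>\<^bsub>D\<^esub> inv_F (fst q)) = inv_F (fst q)"
    using I x'(2) by (intro D.inverse_of_cancel[OF D.inverse_of_sym[OF inv_F[OF x(1)]]]) simp_all
  finally show ?thesis
    by (simp add: span_val_def)
qed

definition extension :: "('o, ('a \<times> 'a) set set, 'q, 'c) func" where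
  "extension = \<lparr>omap = omap F,
     amap = (\<lambda>X. span_val (SOME p. p \<in> spans C S \<and> X = retr_class p))\<rparr>"

lemma omap_extension [simp]: "omap extension = omap F"
  by (simp add: extension_def)

lemma amap_extension:
  assumes "s \<in> S" "f \<in> Arr C" "Dom C s = Dom C f"
  shows "amap extension (retr_class (s, f)) = amap F f \<cdot>\<^bsub>D\<^esub> inv_F s"
proof -
  define p where "p = (SOME p. p \<in> spans C S \<and> retr_class (s, f) = retr_class p)"
  have sf: "(s, f) \<in> spans C S"
    using assms by simp
  then have "p \<in> spans C S \<and> retr_class (s, f) = retr_class p"
    unfolding p_def by - (rule someI[of _ "(s, f)"], simp)
  \<comment> \<open>The value does not depend on the chosen representative, because
    \<open>span_val\<close> is invariant under steps in \<open>S\<close>.\<close>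
  then have "span_val (s, f) = span_val p"
    by (intro retr_class_invariant[of span_val, OF span_val_step _ sf]) simp_all
  then show ?thesis
    by (simp add: extension_def p_def span_val_def)
qed

text \<open>The exchange law for fractions: it moves an inverse past an arrow, as needed to compare
  the extension of a composite with the composite of the extensions.\<close>

lemma inv_F_pullback:
  assumes t: "t \<in> S" and pb: "is_pullback C f t t' f'"
  shows "inv_F t \<cdot>\<^bsub>D\<^esub> amap F f = amap F f' \<cdot>\<^bsub>D\<^esub> inv_F t'"
proof -
  note P = is_pullbackD[OF pb]
  have t': "t' \<in> S"
    by (rule S_pullback[OF t pb])
  note I = inv_F_closed[OF t] inv_F_closed[OF t']
  \<comment> \<open>The identity \<open>amap F t' \<cdot> inv_F t'\<close> is inserted to bring the
    commutativity of the square into play.\<close>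
  have "inv_F t \<cdot>\<^bsub>D\<^esub> amap F f = inv_F t \<cdot>\<^bsub>D\<^esub> (amap F f \<cdot>\<^bsub>D\<^esub> (amap F t' \<cdot>\<^bsub>D\<^esub> inv_F t'))"
    using inv_F[OF t'] P(1,3,7) by (simp add: D.inverse_of_def F_simps D.Comp_Idt')
  also have "\<dots> = inv_F t \<cdot>\<^bsub>D\<^esub> ((amap F f \<cdot>\<^bsub>D\<^esub> amap F t') \<cdot>\<^bsub>D\<^esub> inv_F t')"
    using I P(1,3,7) by (simp add: F_simps D.Comp_assoc)
  also have "amap F f \<cdot>\<^bsub>D\<^esub> amap F t' = amap F t \<cdot>\<^bsub>D\<^esub> amap F f'"
    using P F_simps(6)[of t' f] F_simps(6)[of f' t] by simp
  also have "inv_F t \<cdot>\<^bsub>D\<^esub> ((amap F t \<cdot>\<^bsub>D\<^esub> amap F f') \<cdot>\<^bsub>D\<^esub> inv_F t') =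
      inv_F t \<cdot>\<^bsub>D\<^esub> (amap F t \<cdot>\<^bsub>D\<^esub> (amap F f' \<cdot>\<^bsub>D\<^esub> inv_F t'))"
    using I P(2,4,6,8) by (simp add: F_simps D.Comp_assoc)
  also have "\<dots> = amap F f' \<cdot>\<^bsub>D\<^esub> inv_F t'"
    using I P(2,4,6,8)
    by (intro D.inverse_of_cancel[OF inv_F[OF t]]) (simp_all add: F_simps D.Comp_closed D.Cod_Comp)
  finally show ?thesis .
qed

lemma is_functor_extension: "is_functor (Retr C S) D extension"
  unfolding is_functor_def
proof (intro conjI ballI impI)
  show "category (Retr C S)" "category D"
    by (rule category_Retr, rule D.category_axioms)
next
  fix A assume A: "A \<in> Obj (Retr C S)"
  then show "omap extension A \<in> Obj D"
    using F_simps(1) by simp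
  have "amap F (Idt C A) \<cdot>\<^bsub>D\<^esub> inv_F (Idt C A) = Idt D (omap F A)"
    using inv_F[OF Idt_in_S] A F_simps(1,2) by (simp add: D.inverse_of_def D.Cod_Idt)
  then show "amap extension (Idt (Retr C S) A) = Idt D (omap extension A)"
    using A by (simp add: amap_extension Idt_in_S Idt_closed)
next
  fix X assume "X \<in> Arr (Retr C S)"
  then obtain s f where X: "s \<in> S" "f \<in> Arr C" "Dom C s = Dom C f" "X = retr_class (s, f)"
      "Dom (Retr C S) X = Cod C s" "Cod (Retr C S) X = Cod C f"
    by (rule Retr_ArrE)
  show "amap extension X \<in> Arr D" "Dom D (amap extension X) = omap extension (Dom (Retr C S) X)"
    "Cod D (amap extension X) = omap extension (Cod (Retr C S) X)"
    unfolding X(5,6) unfolding X(4) using X(1-3) inv_F_closed[OF X(1)]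
    by (simp_all add: amap_extension F_simps D.Comp_closed D.Dom_Comp D.Cod_Comp)
next
  fix X Y assume XY: "X \<in> Arr (Retr C S)" "Y \<in> Arr (Retr C S)" "Dom (Retr C S) Y = Cod (Retr C S) X"
  obtain s f t g t' f' where X: "s \<in> S" "f \<in> Arr C" "Dom C s = Dom C f" "X = retr_class (s, f)"
      and Y: "t \<in> S" "g \<in> Arr C" "Dom C t = Dom C g" "Y = retr_class (t, g)"
      and pb: "is_pullback C f t t' f'" "t' \<in> S"
      and c: "s \<cdot>\<^bsub>C\<^esub> t' \<in> S" "g \<cdot>\<^bsub>C\<^esub> f' \<in> Arr C" "Dom C (s \<cdot>\<^bsub>C\<^esub> t') = Dom C (g \<cdot>\<^bsub>C\<^esub> f')"
      and comp: "Y \<cdot>\<^bsub>Retr C S\<^esub> X = retr_class (s \<cdot>\<^bsub>C\<^esub> t', g \<cdot>\<^bsub>C\<^esub> f')"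
    by (rule Retr_CompE[OF XY])
  note P = is_pullbackD[OF pb(1)]
  note I = inv_F_closed[OF X(1)] inv_F_closed[OF Y(1)] inv_F_closed[OF pb(2)]
  have "amap extension (Y \<cdot>\<^bsub>Retr C S\<^esub> X) =
      (amap F g \<cdot>\<^bsub>D\<^esub> amap F f') \<cdot>\<^bsub>D\<^esub> (inv_F t' \<cdot>\<^bsub>D\<^esub> inv_F s)"
    unfolding comp using X Y P(4,7,8) pb(2) c by (simp add: amap_extension F_simps inv_F_Comp)
  also have "\<dots> = amap F g \<cdot>\<^bsub>D\<^esub> ((amap F f' \<cdot>\<^bsub>D\<^esub> inv_F t') \<cdot>\<^bsub>D\<^esub> inv_F s)"
    using X Y P(4,6-8) I
    by (simp add: F_simps D.Comp_assoc D.Comp_closed D.Dom_Comp D.Cod_Comp)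
  \<comment> \<open>Exchanging the two inner factors separates the contribution of \<open>Y\<close>
    from that of \<open>X\<close>.\<close>
  also have "\<dots> = amap F g \<cdot>\<^bsub>D\<^esub> ((inv_F t \<cdot>\<^bsub>D\<^esub> amap F f) \<cdot>\<^bsub>D\<^esub> inv_F s)"
    unfolding inv_F_pullback[OF Y(1) pb(1)] ..
  also have "\<dots> = (amap F g \<cdot>\<^bsub>D\<^esub> inv_F t) \<cdot>\<^bsub>D\<^esub> (amap F f \<cdot>\<^bsub>D\<^esub> inv_F s)"
    using X Y P(5) I
    by (simp add: F_simps D.Comp_assoc D.Comp_closed D.Dom_Comp D.Cod_Comp)
  finally show "amap extension (Y \<cdot>\<^bsub>Retr C S\<^esub> X) = amap extension Y \<cdot>\<^bsub>D\<^esub> amap extension X"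
    using X Y by (simp add: amap_extension)
qed

text \<open>The denominator is an identity, and the inverse of its image is an identity as
  well.\<close>

lemma extension_retr_functor: "functor_eq C (comp_functor extension (retr_functor C S)) F"
proof -
  have "amap F f \<cdot>\<^bsub>D\<^esub> inv_F (Idt C (Dom C f)) = amap F f" if f: "f \<in> Arr C" for f
  proof -
    have A: "Dom C f \<in> Obj C" "Idt C (Dom C f) \<in> S"
      using f Dom_closed Idt_in_S by auto
    have "inv_F (Idt C (Dom C f)) = Idt D (omap F (Dom C f))"
      using inv_F[OF A(2)] D.inverse_of_Idt[OF F_simps(1)[OF A(1)]] F_simps(2)[OF A(1)]
        D.inverse_of_unique by simp
    then show ?thesis
      using f by (simp add: F_simps D.Comp_Idt')
  qed
  then show ?thesis
    unfolding functor_eq_def comp_functor_def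
    by (simp add: amap_extension Idt_Dom_in_S Dom_Idt Dom_closed)
qed

text \<open>By the decomposition of classes, \<open>G\<close> is determined by its values on
  \<open>(1, f)\<close>, which are prescribed by \<open>F\<close>, and on \<open>(s, 1)\<close>,
  which are forced to be inverses.\<close>

lemma extension_unique:
  assumes mono: "\<forall>s\<in>S. monomorphism C s"
    and G: "is_functor (Retr C S) D G" and GF: "functor_eq C (comp_functor G (retr_functor C S)) F"
  shows "functor_eq (Retr C S) G extension"
  unfolding functor_eq_def
proof (intro conjI ballI)
  fix A assume "A \<in> Obj (Retr C S)"
  then show "omap G A = omap extension A"
    using GF by (simp add: functor_eq_def comp_functor_def)
next
  have G_eq: "amap G (retr_class (Idt C (Dom C f), f)) = amap F f" if "f \<in> Arr C" for f
    using GF that by (simp add: functor_eq_def comp_functor_def)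
  fix X assume "X \<in> Arr (Retr C S)"
  then obtain s f where X: "s \<in> S" "s \<in> Arr C" "f \<in> Arr C" "Dom C s = Dom C f" "X = retr_class (s, f)"
    by (rule Retr_ArrE)
  have A: "Dom C f \<in> Obj C" "Idt C (Dom C f) \<in> S"
    using X Dom_closed Idt_in_S by auto
  \<comment> \<open>Functors preserve inverses, and the class of \<open>(s, 1)\<close> is inverse to
    the image of \<open>s\<close> in the quotient.\<close>
  have "D.inverse_of (amap F s) (amap G (retr_class (s, Idt C (Dom C s))))"
    using functor_inverse_of[OF G inverse_of_retr_functor[OF X(1)]] mono X(1) G_eq[OF X(2)] by simp
  then have inv: "amap G (retr_class (s, Idt C (Dom C s))) = inv_F s"
    using inv_F[OF X(1)] D.inverse_of_unique by blast
  have "amap G X = amap G (retr_class (Idt C (Dom C f), f)) \<cdot>\<^bsub>D\<^esub>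
      amap G (retr_class (s, Idt C (Dom C s)))"
    unfolding X(5) retr_class_decomp[OF X(1,3,4)] using X A
    by (intro is_functorD(8)[OF G]) (simp_all add: retr_class_in_Arr Retr_Dom_Cod' cat_simps)
  also have "\<dots> = amap extension X"
    unfolding inv G_eq[OF X(3)] X(5) using X by (simp add: amap_extension)
  finally show "amap G X = amap extension X" .
qed

end

section \<open>The universal property of the quotient and the comparison isomorphism\<close>

lemma (in span_base) category_of_fractions_Retr:
  assumes mono: "\<forall>s\<in>S. monomorphism C s"
  shows "category_of_fractions C S (Retr C S) (retr_functor C S) TYPE('q \<times> 'c)"
  unfolding category_of_fractions_def
proof (intro conjI allI impI)
  show "is_functor C (Retr C S) (retr_functor C S)" "inverts S (Retr C S) (retr_functor C S)"
    by (rule is_functor_retr_functor, rule inverts_retr_functor[OF mono])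
  fix D :: "('q, 'c) cat" and F
  assume "is_functor C D F \<and> inverts S D F"
  then interpret inverting_functor C S D F
    by unfold_locales simp_all
  show "\<exists>G. is_functor (Retr C S) D G \<and> functor_eq C (comp_functor G (retr_functor C S)) F \<and>
      (\<forall>G'. is_functor (Retr C S) D G' \<and> functor_eq C (comp_functor G' (retr_functor C S)) F \<longrightarrow>
        functor_eq (Retr C S) G' G)"
    using is_functor_extension extension_retr_functor extension_unique[OF mono] by blast
qed

theorem corollary1:
  fixes C :: "('o, 'a) cat" and S :: "'a set"
  assumes "span_base C S"
    and "\<forall>s\<in>S. monomorphism C s"
  shows "category_of_fractions C S (Retr C S) (retr_functor C S) TYPE('q \<times> 'c) \<and>
    (\<forall>(K :: ('q, 'c) cat) L.
       category_of_fractions C S K L TYPE('q \<times> 'c) \<and>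
       category_of_fractions C S K L TYPE('o \<times> ('a \<times> 'a) set set) \<longrightarrow>
       (\<exists>I. category_iso (Retr C S) K I \<and>
            functor_eq C (comp_functor I (retr_functor C S)) L))"
proof (intro conjI allI impI)
  interpret span_base C S by (rule assms(1))
  show *: "category_of_fractions C S (Retr C S) (retr_functor C S) TYPE('q \<times> 'c)"
    using assms(2) by (rule category_of_fractions_Retr)
  fix K :: "('q, 'c) cat" and L
  assume "category_of_fractions C S K L TYPE('q \<times> 'c) \<and>
    category_of_fractions C S K L TYPE('o \<times> ('a \<times> 'a) set set)"
  \<comment> \<open>The universal property of the quotient is used at two instances: at the types of
    \<open>K\<close>, and at the types of \<open>Retr C S\<close> itself.\<close>
  then show "\<exists>I. category_iso (Retr C S) K I \<and> functor_eq C (comp_functor I (retr_functor C S)) L"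
    using category_of_fractions_unique[OF _ * category_of_fractions_Retr[OF assms(2)]] by blast
qed

end
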